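(* Let $k\in\mathbb N$ and let $I$ be an ideal of $\mathcal R^k_{[1]}(\mathbb R^2)$. Then there exists $f\in I$ such that for every $g\in I$ there exist an integer $N\in\mathbb N$ and $h\in\mathcal R^k_{[1]}(\mathbb R^2)$ with $g^N=fh$. In particular, there exists $f\in I$ with $\sqrt{I}=\sqrt{(f)}$.
   Context: For $k\in\mathbb N\cup\{\infty\}$, $\mathcal R^k(\mathbb R^2)$ denotes the ring of functions $f:\mathbb R^2\to\mathbb R$ of class $C^k$ that coincide with $p/q$ ($p,q$ polynomials, $q$ nonvanishing there) on some nonempty Zariski open set. For $l\in\mathbb N$: consider compositions $\pi:M\to\mathbb R^2$ of successive blowings-up $M_i\to M_{i-1}$ ($M_0=\mathbb R^2$), each centred at points. An infinitely near point of order $j$ is a sequence $a_0\in M_0,\dots,a_j\in M_j$ where $M_i$ is the blowing-up of $M_{i-1}$ at $a_{i-1}$ and $a_i$ maps to $a_{i-1}$; the number of stages of $\pi$ is the maximal order of infinitely near points in $M$. $\mathcal R^k_{[l]}(\mathbb R^2)$ is the set of $f\in\mathcal R^k(\mathbb R^2)$ for which there is such a $\pi$ with at most $l$ stages such that $f\circ\pi$ is regular on $M$. *)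

theory Defs
  imports "HOL-Analysis.Analysis"
begin

type_synonym pt = "real \<times> real"

definition polyfun2 :: "(pt \<Rightarrow> real) \<Rightarrow> bool" where
  "polyfun2 p \<longleftrightarrow> (\<exists>n c. \<forall>x y. p (x, y) = (\<Sum>i\<le>n. \<Sum>j\<le>n. c i j * x ^ i * y ^ j))"

definition zariski_closed :: "pt set \<Rightarrow> bool" where
  "zariski_closed S \<longleftrightarrow>
     (\<exists>P. finite P \<and> (\<forall>p\<in>P. polyfun2 p) \<and> S = {z. \<forall>p\<in>P. p z = 0})"

definition zariski_open :: "pt set \<Rightarrow> bool" where
  "zariski_open U \<longleftrightarrow> zariski_closed (- U)"

fun Ck :: "nat \<Rightarrow> (pt \<Rightarrow> real) \<Rightarrow> bool" where
  "Ck 0 f = continuous_on UNIV f"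
| "Ck (Suc n) f = (\<exists>g1 g2. (\<forall>z. (f has_derivative (\<lambda>(h1, h2). g1 z * h1 + g2 z * h2)) (at z))
                          \<and> Ck n g1 \<and> Ck n g2)"

definition Rk :: "nat \<Rightarrow> (pt \<Rightarrow> real) set" where
  "Rk k = {f. Ck k f \<and> (\<exists>p q U. polyfun2 p \<and> polyfun2 q \<and> zariski_open U \<and> U \<noteq> {}
               \<and> (\<forall>z\<in>U. q z \<noteq> 0 \<and> f z = p z / q z))}"

definition regular_on :: "pt set \<Rightarrow> (pt \<Rightarrow> real) \<Rightarrow> bool" where
  "regular_on S F \<longleftrightarrow> (\<forall>x\<in>S. \<exists>p q. polyfun2 p \<and> polyfun2 q \<and> q x \<noteq> 0 \<and>
                         (\<forall>y\<in>S. q y \<noteq> 0 \<longrightarrow> F y = p y / q y))"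

text \<open>Regularity of f \<circ> \<pi> on the blowing-up M of R^2 at a finite set A of (distinct) points,
  expressed via the standard affine open cover of M:
  the part over R^2 - A, and for each a in A the two standard charts
  (u,v) |-> (a1+u, a2+uv) and (u,v) |-> (a1+uv, a2+v) (restricted to the complement
  of the preimages of the other blown-up points).\<close>
definition regular_after_blowup :: "pt set \<Rightarrow> (pt \<Rightarrow> real) \<Rightarrow> bool" where
  "regular_after_blowup A f \<longleftrightarrow>
     regular_on (- A) f \<and>
     (\<forall>a\<in>A.
        regular_on {(u, v). (fst a + u, snd a + u * v) \<notin> A - {a}}
                   (\<lambda>(u, v). f (fst a + u, snd a + u * v)) \<and>
        regular_on {(u, v). (fst a + u * v, snd a + v) \<notin> A - {a}}
                   (\<lambda>(u, v). f (fst a + u * v, snd a + v)))"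

text \<open>R^k_[1](R^2): a composition of point blowings-up with at most one stage is the
  blowing-up of finitely many distinct points of R^2 (possibly none).\<close>
definition Rk1 :: "nat \<Rightarrow> (pt \<Rightarrow> real) set" where
  "Rk1 k = {f \<in> Rk k. \<exists>A. finite A \<and> regular_after_blowup A f}"

definition is_ideal_in :: "(pt \<Rightarrow> real) set \<Rightarrow> (pt \<Rightarrow> real) set \<Rightarrow> bool" where
  "is_ideal_in R I \<longleftrightarrow> I \<subseteq> R \<and> (\<lambda>_. 0) \<in> I \<and>
     (\<forall>a\<in>I. \<forall>b\<in>I. (\<lambda>z. a z + b z) \<in> I) \<and>
     (\<forall>r\<in>R. \<forall>a\<in>I. (\<lambda>z. r z * a z) \<in> I)"

definition principal_ideal :: "(pt \<Rightarrow> real) set \<Rightarrow> (pt \<Rightarrow> real) \<Rightarrow> (pt \<Rightarrow> real) set" where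
  "principal_ideal R f = {g. \<exists>h\<in>R. g = (\<lambda>z. f z * h z)}"

definition radical_in :: "(pt \<Rightarrow> real) set \<Rightarrow> (pt \<Rightarrow> real) set \<Rightarrow> (pt \<Rightarrow> real) set" where
  "radical_in R I = {g \<in> R. \<exists>N::nat. (\<lambda>z. g z ^ N) \<in> I}"

end

theory Submission
  imports Defs "HOL-Library.Landau_Symbols" "HOL-Computational_Algebra.Field_as_Ring"
    "HOL-Computational_Algebra.Polynomial_Factorial"
begin

text \<open>
  Call a polynomial definite if at every point its initial form has no nontrivial real zero. A
  function of class \<open>C\<^sup>k\<close> lies in \<open>Rk1 k\<close> iff it is a fraction \<open>P / Q\<close> of polynomials with \<open>Q\<close>
  definite.

  Let \<open>d\<close> be the greatest common divisor of the polynomials in the ideal \<open>I\<close>. Clearing denominators,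
  every \<open>g \<in> I\<close> is \<open>d P / Q\<close> with \<open>Q\<close> definite; and the polynomials of \<open>I\<close> divided by \<open>d\<close> contain
  nonzero polynomials in \<open>x\<close> alone and in \<open>y\<close> alone, hence a definite polynomial \<open>D\<close>, so that
  \<open>d D \<in> I\<close>. The zeros of \<open>D\<close> are finitely many, and so are the zeros of \<open>d\<close> outside the zero set
  \<open>Z(I)\<close>, because \<open>d\<close> is definite at such points and the derivative of an irreducible factor vanishes
  there. Hence some \<open>G = d P / V \<in> I\<close> is nonzero at every point of \<open>Z(d D) - Z(I)\<close>, and
  \<open>f = (d D)\<^sup>2 + G\<^sup>2\<^sup>n\<close> has the zero set \<open>Z(I)\<close>. For large \<open>n\<close> we have \<open>f V\<^sup>2\<^sup>n = d\<^sup>2 W\<close> with \<open>W\<close>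
  definite, since \<open>G V = d P\<close> vanishes to a higher order than \<open>V\<close> at the zeros of \<open>G\<close>. In the same
  way \<open>g Q = d P\<close> vanishes on \<open>Z(I)\<close> to a higher order than \<open>Q\<close>, so that for large \<open>N\<close> the fraction
  \<open>g\<^sup>N / f\<close> has a definite denominator and is of class \<open>C\<^sup>k\<close>.
\<close>

section \<open>Polynomial functions of two variables\<close>

definition poly2 :: "'a::comm_ring_1 poly poly \<Rightarrow> 'a \<times> 'a \<Rightarrow> 'a" where
  "poly2 p z = poly (poly p [:fst z:]) (snd z)"

lemma poly2_simps [simp]:
  "poly2 0 z = 0" "poly2 1 z = 1" "poly2 (p + q) z = poly2 p z + poly2 q z"
  "poly2 (p - q) z = poly2 p z - poly2 q z" "poly2 (p * q) z = poly2 p z * poly2 q z"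
  "poly2 (p ^ n) z = poly2 p z ^ n" "poly2 (monom c n) z = poly c (snd z) * fst z ^ n"
  "poly2 (pCons c p) z = poly c (snd z) + fst z * poly2 p z"
  by (simp_all add: poly2_def poly_monom poly_power)

lemma poly2_sum: "poly2 (\<Sum>i\<in>A. p i) z = (\<Sum>i\<in>A. poly2 (p i) z)"
  by (induction A rule: infinite_finite_induct) auto

lemma poly2_inject [simp]:
  fixes p q :: "'a::{idom,ring_char_0} poly poly"
  shows "poly2 p = poly2 q \<longleftrightarrow> p = q"
proof
  assume "poly2 p = poly2 q"
  then have "poly2 (p - q) (x, y) = 0" for x y by simp
  then have "poly (poly (p - q) [:x:]) y = 0" for x y unfolding poly2_def by simp
  then have "poly (p - q) [:x:] = 0" for x using poly_all_0_iff_0 by blast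
  then have "range (\<lambda>x. [:x:]) \<subseteq> {r. poly (p - q) r = 0}" by auto
  moreover have "infinite (range (\<lambda>x::'a. [:x:]))"
    using infinite_UNIV_char_0[where 'a='a] by (subst finite_image_iff) (auto intro: injI)
  ultimately have "infinite {r. poly (p - q) r = 0}" using finite_subset by blast
  then show "p = q" using poly_roots_finite[of "p - q"] by auto
qed simp

lemma poly2_eq_0_iff:
  fixes p :: "'a::{idom,ring_char_0} poly poly"
  shows "poly2 p = (\<lambda>_. 0) \<longleftrightarrow> p = 0"
  using poly2_inject[of p 0] by (simp add: fun_eq_iff)

lemma poly_eq_sum_le:
  fixes p :: "'a::comm_semiring_1 poly"
  assumes "degree p \<le> n" shows "poly p x = (\<Sum>i\<le>n. coeff p i * x ^ i)"
  unfolding poly_altdef by (rule sum.mono_neutral_left) (use assms in \<open>auto simp: coeff_eq_0\<close>)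

lemma polyfun2_poly2: "polyfun2 (poly2 p)"
proof -
  define n where "n = degree p + (\<Sum>i\<le>degree p. degree (coeff p i))"
  have deg: "degree (coeff p i) \<le> n" for i
    by (cases "i \<le> degree p") (auto simp: n_def coeff_eq_0 intro: member_le_sum trans_le_add2)
  have "poly2 p (x, y) = (\<Sum>i\<le>n. \<Sum>j\<le>n. coeff (coeff p i) j * x ^ i * y ^ j)" for x y
  proof -
    have "poly2 p (x, y) = (\<Sum>i\<le>n. poly (coeff p i) y * x ^ i)"
      unfolding poly2_def by (subst poly_eq_sum_le[of p n]) (auto simp: n_def poly_sum poly_power)
    also have "\<dots> = (\<Sum>i\<le>n. \<Sum>j\<le>n. coeff (coeff p i) j * x ^ i * y ^ j)"
      using deg by (simp add: poly_eq_sum_le[of _ n] sum_distrib_right sum_distrib_left mult_ac)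
    finally show ?thesis .
  qed
  then show ?thesis unfolding polyfun2_def by fast
qed

lemma polyfun2_iff_poly2: "polyfun2 f \<longleftrightarrow> f \<in> range poly2"
proof
  assume "polyfun2 f"
  then obtain n c where c: "\<And>x y. f (x, y) = (\<Sum>i\<le>n. \<Sum>j\<le>n. c i j * x ^ i * y ^ j)"
    unfolding polyfun2_def by blast
  have "f = poly2 (\<Sum>i\<le>n. \<Sum>j\<le>n. monom (monom (c i j) j) i)"
    by (auto simp: fun_eq_iff poly2_sum c poly_monom mult_ac)
  then show "f \<in> range poly2" by blast
qed (use polyfun2_poly2 in blast)

lemma polyfun2E:
  assumes "polyfun2 f" obtains p where "f = poly2 p"
  using assms polyfun2_iff_poly2 by blast

named_theorems polyfun2_intros

declare polyfun2_poly2 [polyfun2_intros]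

lemma polyfun2_const [polyfun2_intros]: "polyfun2 (\<lambda>z. c)"
  unfolding polyfun2_iff_poly2 by (rule range_eqI[of _ _ "[:[:c:]:]"]) auto

lemma polyfun2_fst [polyfun2_intros]: "polyfun2 fst"
  unfolding polyfun2_iff_poly2 by (rule range_eqI[of _ _ "[:0, 1:]"]) (auto simp: one_pCons)

lemma polyfun2_snd [polyfun2_intros]: "polyfun2 snd"
  unfolding polyfun2_iff_poly2 by (rule range_eqI[of _ _ "[:[:0, 1:]:]"]) auto

lemma polyfun2_add [polyfun2_intros]: "polyfun2 f \<Longrightarrow> polyfun2 g \<Longrightarrow> polyfun2 (\<lambda>z. f z + g z)"
  by (elim polyfun2E) (simp flip: poly2_simps add: polyfun2_poly2)

lemma polyfun2_diff [polyfun2_intros]: "polyfun2 f \<Longrightarrow> polyfun2 g \<Longrightarrow> polyfun2 (\<lambda>z. f z - g z)"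
  by (elim polyfun2E) (simp flip: poly2_simps add: polyfun2_poly2)

lemma polyfun2_mult [polyfun2_intros]: "polyfun2 f \<Longrightarrow> polyfun2 g \<Longrightarrow> polyfun2 (\<lambda>z. f z * g z)"
  by (elim polyfun2E) (simp flip: poly2_simps add: polyfun2_poly2)

lemma polyfun2_power [polyfun2_intros]: "polyfun2 f \<Longrightarrow> polyfun2 (\<lambda>z. f z ^ n)"
  by (induction n) (auto intro: polyfun2_intros)

lemma polyfun2_sum [polyfun2_intros]:
  "(\<And>i. i \<in> A \<Longrightarrow> polyfun2 (f i)) \<Longrightarrow> polyfun2 (\<lambda>z. \<Sum>i\<in>A. f i z)"
  by (induction A rule: infinite_finite_induct) (auto intro: polyfun2_intros)

lemma polyfun2_compose:
  assumes "polyfun2 f" "polyfun2 a" "polyfun2 b"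
  shows "polyfun2 (\<lambda>z. f (a z, b z))"
proof -
  obtain n c where c: "\<And>x y. f (x, y) = (\<Sum>i\<le>n. \<Sum>j\<le>n. c i j * x ^ i * y ^ j)"
    using assms(1) unfolding polyfun2_def by blast
  show ?thesis unfolding c using assms by (intro polyfun2_intros)
qed

lemma polyfun2_poly [polyfun2_intros]: "polyfun2 f \<Longrightarrow> polyfun2 (\<lambda>z. poly p (f z))"
  unfolding poly_altdef by (intro polyfun2_intros)

lemma polyfun2_swap: "polyfun2 f \<Longrightarrow> polyfun2 (\<lambda>z. f (prod.swap z))"
  unfolding prod.swap_def by (intro polyfun2_compose polyfun2_intros)

lemma polyfun2_mult_eq_0:
  assumes "polyfun2 f" "polyfun2 g" "\<And>z. f z * g z = 0"
  shows "f = (\<lambda>_. 0) \<or> g = (\<lambda>_. 0)"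
proof -
  obtain p q where p: "f = poly2 p" and q: "g = poly2 q" using assms polyfun2E by metis
  have "poly2 (p * q) = (\<lambda>_. 0)" using assms(3) by (auto simp: p q)
  then show ?thesis using poly2_eq_0_iff[of "p * q"] poly2_eq_0_iff[of p] poly2_eq_0_iff[of q] p q
    by auto
qed

lemma continuous_on_polyfun2:
  assumes "polyfun2 f" shows "continuous_on A f"
proof -
  obtain n c where c: "\<And>x y. f (x, y) = (\<Sum>i\<le>n. \<Sum>j\<le>n. c i j * x ^ i * y ^ j)"
    using assms unfolding polyfun2_def by blast
  have "f = (\<lambda>z. \<Sum>i\<le>n. \<Sum>j\<le>n. c i j * fst z ^ i * snd z ^ j)" by (auto simp: fun_eq_iff c)
  then show ?thesis by (auto intro!: continuous_intros)
qed

lemma isCont_polyfun2: "polyfun2 f \<Longrightarrow> isCont f z"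
  using continuous_on_polyfun2[of f UNIV] continuous_on_eq_continuous_at by blast

abbreviation has_partials :: "(pt \<Rightarrow> real) \<Rightarrow> real \<Rightarrow> real \<Rightarrow> pt \<Rightarrow> bool" where
  "has_partials f a b z \<equiv> (f has_derivative (\<lambda>(h1, h2). a * h1 + b * h2)) (at z)"

lemma has_partials_unique:
  assumes "has_partials f a b z" "has_partials f a' b' z"
  shows "a = a'" "b = b'"
proof -
  have "(\<lambda>(h1, h2). a * h1 + b * h2) = (\<lambda>(h1, h2). a' * h1 + b' * h2)"
    by (rule has_derivative_unique[OF assms])
  from fun_cong[OF this, of "(1, 0)"] fun_cong[OF this, of "(0, 1)"] show "a = a'" "b = b'" by auto
qed

lemma has_partials_poly2:
  "has_partials (poly2 p) (poly2 (pderiv p) z) (poly2 (map_poly pderiv p) z) z"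
proof (induction p)
  case (pCons c p)
  have "((\<lambda>w. poly c (snd w) + fst w * poly2 p w) has_derivative
      (\<lambda>h. snd h * poly (pderiv c) (snd z) + (fst z * (\<lambda>(h1, h2). poly2 (pderiv p) z * h1 +
        poly2 (map_poly pderiv p) z * h2) h + fst h * poly2 p z))) (at z)"
    using pCons.IH by (auto intro!: derivative_eq_intros DERIV_compose_FDERIV[OF poly_DERIV])
  then have "((\<lambda>w. poly c (snd w) + fst w * poly2 p w) has_derivative
      (\<lambda>(h1, h2). poly2 (pderiv (pCons c p)) z * h1 + poly2 (map_poly pderiv (pCons c p)) z * h2))
    (at z)"
    by (rule has_derivative_eq_rhs) (auto simp: pderiv_pCons map_poly_pCons algebra_simps)
  then show ?case by (simp add: fun_eq_iff)
qed (auto simp: case_prod_unfold)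

lemma polyfun2_has_partials:
  assumes "polyfun2 f"
  obtains f1 f2 where "polyfun2 f1" "polyfun2 f2" "\<And>z. has_partials f (f1 z) (f2 z) z"
  using assms has_partials_poly2 polyfun2_poly2 by (elim polyfun2E) blast

section \<open>Ideals of bivariate polynomials\<close>

lemma module_mult: "module ((*) :: 'a::comm_ring_1 \<Rightarrow> 'a \<Rightarrow> 'a)"
  by unfold_locales (simp_all add: algebra_simps)

abbreviation ring_ideal :: "'a::comm_ring_1 set \<Rightarrow> bool" where
  "ring_ideal \<equiv> module.subspace (*)"

abbreviation ideal_span :: "'a::comm_ring_1 set \<Rightarrow> 'a set" where
  "ideal_span \<equiv> module.span (*)"

lemmas ring_idealI = module.subspaceI[OF module_mult]
  and ring_ideal_0 = module.subspace_0[OF module_mult]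
  and ring_ideal_add = module.subspace_add[OF module_mult]
  and ring_ideal_diff = module.subspace_diff[OF module_mult]
  and ring_ideal_mult = module.subspace_scale[OF module_mult]

text \<open>
  Pseudo-division by \<open>m\<close> leaves no remainder, and the lemma of Gauss cancels the pseudo-divisor.
\<close>
lemma primitive_part_minimal_degree_dvd:
  fixes J :: "'a::{factorial_ring_gcd,semiring_gcd_mult_normalize} poly set"
  assumes J: "ring_ideal J" and m: "m \<in> J" "m \<noteq> 0"
    and min: "\<And>p. p \<in> J \<Longrightarrow> p \<noteq> 0 \<Longrightarrow> degree m \<le> degree p" and p: "p \<in> J"
  shows "primitive_part m dvd p"
proof -
  obtain q r where qr: "pseudo_divmod p m = (q, r)" by fastforce
  define k where "k = lead_coeff m ^ (Suc (degree p) - degree m)"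
  have "k \<noteq> 0" using m(2) by (simp add: k_def)
  have eq: "smult k p = m * q + r" and r: "r = 0 \<or> degree r < degree m"
    using pseudo_divmod[OF m(2) qr] by (auto simp: k_def)
  have "r = [:k:] * p - q * m" using eq by (simp add: algebra_simps)
  then have "r \<in> J" using ring_ideal_diff ring_ideal_mult J m(1) p by metis
  then have "r = 0" using r min by force
  then have "primitive_part m dvd primitive_part (smult k p)"
    using eq by (intro primitive_part_dvd_primitive_partI) auto
  also have "\<dots> = [:unit_factor k:] * primitive_part p" by (simp add: primitive_part_smult)
  also have "\<dots> dvd primitive_part p"
    using \<open>k \<noteq> 0\<close> by (subst mult_unit_dvd_iff') (simp_all add: is_unit_const_poly_iff)
  also have "\<dots> dvd p" by (metis content_times_primitive_part dvd_refl dvd_smult)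
  finally show ?thesis .
qed

lemma ideal_smult_Gcd:
  fixes J :: "'a::{factorial_ring_gcd,semiring_gcd_mult_normalize} poly set"
  assumes J: "ring_ideal J" and "\<not> J \<subseteq> {0}"
  obtains c where "c \<noteq> 0" "smult c (Gcd J) \<in> J"
proof -
  obtain m where m: "m \<in> J" "m \<noteq> 0" and min: "\<And>p. p \<in> J \<Longrightarrow> p \<noteq> 0 \<Longrightarrow> degree m \<le> degree p"
    using ex_has_least_nat[of "\<lambda>p. p \<in> J \<and> p \<noteq> 0" _ degree] \<open>\<not> J \<subseteq> {0}\<close> by blast
  have "primitive_part m dvd Gcd J"
    by (intro Gcd_greatest primitive_part_minimal_degree_dvd[OF J m min])
  then obtain e where e: "Gcd J = primitive_part m * e" by (elim dvdE)
  have "primitive_part m * e dvd primitive_part m * [:content m:]"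
    using Gcd_dvd[OF m(1)] by (simp add: e)
  then have "e dvd [:content m:]" using m(2) by (simp del: mult_pCons_right)
  then obtain b where b: "e = [:b:]" using m(2) const_poly_dvd_const_poly_iff
    by (metis content_eq_zero_iff degree_eq_zeroE dvd_imp_degree_le degree_pCons_0 le_zero_eq
        pCons_eq_0_iff)
  have "smult (content m) (Gcd J) = [:b:] * smult (content m) (primitive_part m)"
    by (simp only: e b mult_smult_right mult.commute)
  also have "\<dots> = [:b:] * m" by (simp only: content_times_primitive_part)
  finally have "smult (content m) (Gcd J) = [:b:] * m" .
  then have "smult (content m) (Gcd J) \<in> J" using ring_ideal_mult[OF J m(1), of "[:b:]"] by simp
  with m(2) show ?thesis by (intro that[of "content m"]) auto
qed

definition swap_vars :: "real poly poly \<Rightarrow> real poly poly" where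
  "swap_vars p = (THE q. poly2 q = (\<lambda>z. poly2 p (prod.swap z)))"

lemma poly2_swap_vars [simp]: "poly2 (swap_vars p) z = poly2 p (prod.swap z)"
proof -
  obtain q where q: "(\<lambda>z. poly2 p (prod.swap z)) = poly2 q"
    using polyfun2_swap[OF polyfun2_poly2] by (rule polyfun2E)
  have "swap_vars p = q" unfolding swap_vars_def q by (intro the_equality) simp_all
  then show ?thesis by (simp flip: q)
qed

lemma swap_vars_eqI: "(\<And>z. poly2 p z = poly2 q (prod.swap z)) \<Longrightarrow> p = swap_vars q"
  by (subst poly2_inject[symmetric]) (simp add: fun_eq_iff)

lemma swap_vars_swap_vars [simp]: "swap_vars (swap_vars p) = p"
  by (rule swap_vars_eqI[symmetric]) simp

lemma swap_vars_mult: "swap_vars (p * q) = swap_vars p * swap_vars q"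
  by (rule swap_vars_eqI[symmetric]) simp

lemma swap_vars_add: "swap_vars (p + q) = swap_vars p + swap_vars q"
  by (rule swap_vars_eqI[symmetric]) simp

lemma swap_vars_0 [simp]: "swap_vars 0 = 0"
  by (rule swap_vars_eqI[symmetric]) simp

lemma swap_vars_dvd_iff: "swap_vars p dvd q \<longleftrightarrow> p dvd swap_vars q"
  by (metis dvd_def swap_vars_mult swap_vars_swap_vars)

lemma coprime_swap_vars: 
  assumes "coprime p q" shows "coprime (swap_vars p) (swap_vars q)"
proof (rule coprimeI)
  fix r assume "r dvd swap_vars p" "r dvd swap_vars q"
  then have "is_unit (swap_vars r)"
    using assms coprime_common_divisor by (metis swap_vars_dvd_iff)
  then have "swap_vars r dvd swap_vars 1" by (metis unit_imp_dvd)
  then show "is_unit r" by (simp add: swap_vars_dvd_iff)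
qed

lemma in_swap_vars_image_iff: "p \<in> swap_vars ` J \<longleftrightarrow> swap_vars p \<in> J"
  by (metis image_iff swap_vars_swap_vars)

lemma ideal_swap_vars_image:
  assumes "ring_ideal J" shows "ring_ideal (swap_vars ` J)"
  using ring_ideal_0[OF assms] ring_ideal_add[OF assms] ring_ideal_mult[OF assms]
  by (intro ring_idealI) (simp_all add: in_swap_vars_image_iff swap_vars_add swap_vars_mult)

lemma ideal_univariate_mult_Gcd:
  assumes J: "ring_ideal J" and "\<not> J \<subseteq> {0}"
  obtains c c' where "c \<noteq> 0" "[:c:] * Gcd J \<in> J" "c' \<noteq> 0" "swap_vars [:c':] * Gcd J \<in> J"
proof -
  let ?J' = "swap_vars ` J"
  obtain c where c: "c \<noteq> 0" "smult c (Gcd J) \<in> J" by (rule ideal_smult_Gcd[OF assms])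
  have "\<not> ?J' \<subseteq> {0}" using assms(2)
    by (metis image_subset_iff singleton_iff subsetI swap_vars_0 swap_vars_swap_vars)
  then obtain c' where c': "c' \<noteq> 0" "smult c' (Gcd ?J') \<in> ?J'"
    by (rule ideal_smult_Gcd[OF ideal_swap_vars_image[OF J]])
  have "swap_vars (Gcd ?J') dvd Gcd J"
    by (rule Gcd_greatest) (auto simp: swap_vars_dvd_iff intro: Gcd_dvd)
  then obtain e where e: "Gcd J = swap_vars (Gcd ?J') * e" by (elim dvdE)
  have "swap_vars ([:c':] * Gcd ?J') \<in> J" using c'(2) by (simp add: in_swap_vars_image_iff)
  then have "e * swap_vars ([:c':] * Gcd ?J') \<in> J" by (rule ring_ideal_mult[OF J])
  then have "swap_vars [:c':] * Gcd J \<in> J" by (simp only: e swap_vars_mult mult_ac)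
  with c c'(1) show ?thesis by (intro that) simp_all
qed

lemma ideal_span_pair: "x \<in> ideal_span {p, q} \<longleftrightarrow> (\<exists>a b. x = a * p + b * q)"
  unfolding module.span_insert[OF module_mult, of p "{q}"] module.span_singleton[OF module_mult]
  by (auto simp: image_iff diff_eq_eq) (metis add.commute)+

lemma coprime_bezout_univariate:
  fixes p q :: "real poly poly"
  assumes "coprime p q"
  obtains c c'
    where "c \<noteq> 0" "[:c:] \<in> ideal_span {p, q}" "c' \<noteq> 0" "swap_vars [:c':] \<in> ideal_span {p, q}"
proof -
  have "p \<in> ideal_span {p, q}" "q \<in> ideal_span {p, q}"
    by (simp_all add: module.span_base[OF module_mult])
  then have "Gcd (ideal_span {p, q}) dvd p" "Gcd (ideal_span {p, q}) dvd q"
    by (simp_all only: Gcd_dvd)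
  then have "is_unit (Gcd (ideal_span {p, q}))" by (rule coprime_common_divisor[OF assms])
  then have Gcd: "Gcd (ideal_span {p, q}) = 1" by (metis normalize_Gcd is_unit_normalize)
  then have "\<not> ideal_span {p, q} \<subseteq> {0}" using Gcd_0_iff[of "ideal_span {p, q}"] by auto
  from ideal_univariate_mult_Gcd[OF module.subspace_span[OF module_mult] this] that Gcd show ?thesis
    by auto
qed

lemma finite_common_zeros:
  assumes "coprime p q"
  shows "finite {z. poly2 p z = 0 \<and> poly2 q z = (0::real)}"
proof -
  obtain c c' where c: "c \<noteq> 0" "[:c:] \<in> ideal_span {p, q}"
    and c': "c' \<noteq> 0" "swap_vars [:c':] \<in> ideal_span {p, q}"
    by (rule coprime_bezout_univariate[OF assms])
  have "{z. poly2 p z = 0 \<and> poly2 q z = 0} \<subseteq> {x. poly c' x = 0} \<times> {y. poly c y = 0}"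
  proof safe
    fix x y assume "poly2 p (x, y) = 0" "poly2 q (x, y) = 0"
    then have zero: "poly2 r (x, y) = 0" if "r \<in> ideal_span {p, q}" for r
      using that by (auto simp: ideal_span_pair)
    show "poly c' x = 0" "poly c y = 0" using zero[OF c'(2)] zero[OF c(2)] by simp_all
  qed
  moreover have "finite ({x. poly c' x = 0} \<times> {y. poly c y = 0})"
    using c(1) c'(1) by (intro finite_cartesian_product poly_roots_finite)
  ultimately show ?thesis by (rule finite_subset)
qed

lemma dvd_power_of_rsquarefree:
  fixes p :: "'a::idom poly"
  assumes "p \<noteq> 0" obtains u n where "rsquarefree u" "p dvd u ^ n"
proof -
  have "\<exists>u n. rsquarefree u \<and> p dvd u ^ n" using assms
  proof (induction "degree p" arbitrary: p rule: less_induct)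
    case less
    show ?case
    proof (cases "rsquarefree p")
      case True
      then show ?thesis by (metis dvd_refl power_one_right)
    next
      case False
      then obtain a where "order a p \<ge> 2" using less.prems unfolding rsquarefree_def
        by (metis One_nat_def Suc_1 less_2_cases not_le)
      then have "[:- a, 1:] ^ 2 dvd p" using order_1[of a p] le_imp_power_dvd dvd_trans by blast
      then obtain r where "p = [:- a, 1:] ^ 2 * r" by (elim dvdE)
      moreover define q where "q = [:- a, 1:] * r"
      ultimately have p: "p = [:- a, 1:] * q" by (simp only: power2_eq_square mult.assoc)
      then have "q \<noteq> 0" using less.prems by auto
      moreover from this have "degree q < degree p" unfolding p by (subst degree_mult_eq) auto
      ultimately obtain u n where un: "rsquarefree u" "q dvd u ^ n" using less.hyps by blast
      have "p dvd q * q" unfolding p q_def by (intro mult_dvd_mono dvd_triv_left dvd_refl)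
      also have "\<dots> dvd u ^ n * u ^ n" by (intro mult_dvd_mono un)
      finally show ?thesis using un(1) by (metis power_add)
    qed
  qed
  then show ?thesis using that by blast
qed

section \<open>Taylor forms and orders of vanishing\<close>

text \<open>The value at \<open>z\<close> itself is not constrained.\<close>
abbreviation vanishing_at :: "'a::metric_space \<Rightarrow> nat \<Rightarrow> ('a \<Rightarrow> real) set" where
  "vanishing_at z m \<equiv> O[at z](\<lambda>w. dist w z ^ m)"

abbreviation definite_order_at :: "'a::metric_space \<Rightarrow> nat \<Rightarrow> ('a \<Rightarrow> real) set" where
  "definite_order_at z m \<equiv> \<Theta>[at z](\<lambda>w. dist w z ^ m)"

lemma bigtheta_power: "f \<in> \<Theta>[F](g) \<Longrightarrow> (\<lambda>x. f x ^ n) \<in> \<Theta>[F](\<lambda>x. g x ^ n)"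
  by (induction n) (simp_all add: landau_theta.mult)

lemma power_smallo_power:
  fixes f :: "'a \<Rightarrow> real"
  assumes "(f \<longlongrightarrow> 0) F" "\<forall>\<^sub>F x in F. f x \<noteq> 0" "m < n"
  shows "(\<lambda>x. f x ^ n) \<in> o[F](\<lambda>x. f x ^ m)"
proof (rule smalloI_tendsto)
  have "((\<lambda>x. f x ^ (n - m)) \<longlongrightarrow> 0) F"
    using tendsto_power[OF assms(1), of "n - m"] \<open>m < n\<close> by (simp add: power_0_left)
  moreover have "\<forall>\<^sub>F x in F. f x ^ (n - m) = f x ^ n / f x ^ m"
    using assms(2) by eventually_elim (use \<open>m < n\<close> in \<open>simp add: power_diff\<close>)
  ultimately show "((\<lambda>x. f x ^ n / f x ^ m) \<longlongrightarrow> 0) F" by (rule Lim_transform_eventually)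
  show "\<forall>\<^sub>F x in F. f x ^ m \<noteq> 0" using assms(2) by eventually_elim simp
qed

lemma tendsto_dist_at: "((\<lambda>w. dist w z) \<longlongrightarrow> 0) (at z)"
  using tendsto_dist[OF tendsto_ident_at tendsto_const, of z z] by simp

lemma eventually_dist_nonzero_at: "\<forall>\<^sub>F w in at z. dist w z \<noteq> 0"
  by (simp add: eventually_at_filter)

lemmas dist_power_smallo = power_smallo_power[OF tendsto_dist_at eventually_dist_nonzero_at]

lemma vanishing_at_dist_power: "m \<le> n \<Longrightarrow> (\<lambda>w. dist w z ^ n) \<in> vanishing_at z m"
proof (cases "m = n")
  case False
  assume "m \<le> n"
  with False show ?thesis by (intro landau_o.small_imp_big dist_power_smallo) simp
qed simp

lemma not_dist_power_smallo:
  assumes "m \<le> n" "at z \<noteq> bot" shows "(\<lambda>w. dist w z ^ m) \<notin> o[at z](\<lambda>w. dist w z ^ n)"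
proof
  assume "(\<lambda>w. dist w z ^ m) \<in> o[at z](\<lambda>w. dist w z ^ n)"
  then have "\<forall>\<^sub>F w in at z. dist w z ^ m = 0"
    using vanishing_at_dist_power[OF assms(1)] by (rule landau_o.small_big_asymmetric)
  then have "\<forall>\<^sub>F w in at z. False"
    using eventually_dist_nonzero_at[of z] by eventually_elim simp
  with assms(2) show False by simp
qed

lemma poly_bigtheta_order:
  fixes p :: "real poly"
  assumes "p \<noteq> 0" shows "poly p \<in> \<Theta>[at a](\<lambda>x. (x - a) ^ order a p)"
proof -
  obtain q where q: "p = [:- a, 1:] ^ order a p * q" "\<not> [:- a, 1:] dvd q"
    using order_decomp[OF assms] by blast
  show ?thesis
  proof (rule bigthetaI_tendsto)
    show "poly q a \<noteq> 0" using q(2) by (simp add: dvd_iff_poly_eq_0)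
    have "(poly q \<longlongrightarrow> poly q a) (at a)" by (rule isContD) simp
    moreover have "\<forall>\<^sub>F x in at a. poly q x = poly p x / (x - a) ^ order a p"
      unfolding eventually_at_filter by (subst q(1)) (simp add: poly_power)
    ultimately show "((\<lambda>x. poly p x / (x - a) ^ order a p) \<longlongrightarrow> poly q a) (at a)"
      by (rule Lim_transform_eventually)
  qed
qed

lemma poly_smallo_at_0_iff:
  fixes p :: "real poly"
  shows "poly p \<in> o[at 0](\<lambda>t. \<bar>t\<bar> ^ m) \<longleftrightarrow> (\<forall>s\<le>m. coeff p s = 0)"
proof (cases "p = 0")
  case True then show ?thesis by (simp add: poly_0[abs_def])
next
  case False
  define n where "n = order 0 p"
  have "poly p \<in> \<Theta>[at 0](\<lambda>t. t ^ n)" using poly_bigtheta_order[OF False, of 0] by (simp add: n_def)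
  also have "(\<lambda>t::real. t ^ n) \<in> \<Theta>[at 0](\<lambda>t. \<bar>t\<bar> ^ n)" by (simp flip: power_abs)
  finally have "poly p \<in> o[at 0](\<lambda>t. \<bar>t\<bar> ^ m) \<longleftrightarrow> (\<lambda>t::real. \<bar>t\<bar> ^ n) \<in> o[at 0](\<lambda>t. \<bar>t\<bar> ^ m)"
    by (rule landau_o.small.in_cong_bigtheta)
  also have "\<dots> \<longleftrightarrow> Suc m \<le> n"
    using dist_power_smallo[of m n "0::real"] not_dist_power_smallo[of n m "0::real"]
    by (cases "n \<le> m") (auto simp: dist_real_def)
  also have "\<dots> \<longleftrightarrow> monom 1 (Suc m) dvd p" by (simp add: monom_1_dvd_iff[OF False] n_def)
  also have "\<dots> \<longleftrightarrow> (\<forall>s\<le>m. coeff p s = 0)" by (simp add: monom_1_dvd_iff' less_Suc_eq_le)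
  finally show ?thesis .
qed

definition line_poly :: "(pt \<Rightarrow> real) \<Rightarrow> pt \<Rightarrow> pt \<Rightarrow> real poly" where
  "line_poly f z h = (THE q. \<forall>t. poly q t = f (z + t *\<^sub>R h))"

definition taylor_form :: "(pt \<Rightarrow> real) \<Rightarrow> pt \<Rightarrow> nat \<Rightarrow> pt \<Rightarrow> real" where
  "taylor_form f z s h = coeff (line_poly f z h) s"

lemma line_poly_eqI: 
  assumes "\<And>t. poly q t = f (z + t *\<^sub>R h)" shows "line_poly f z h = q"
  unfolding line_poly_def
proof (rule the_equality)
  fix r assume "\<forall>t. poly r t = f (z + t *\<^sub>R h)"
  with assms have "poly r = poly q" by auto
  then show "r = q" by (simp add: poly_eq_poly_eq_iff)
qed (use assms in blast)

lemma poly_line_expansion: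
  assumes f: "\<And>x y. f (x, y) = (\<Sum>i\<le>n. \<Sum>j\<le>n. c i j * x ^ i * y ^ j)"
  shows "poly (\<Sum>i\<le>n. \<Sum>j\<le>n. smult (c i j) ([:fst z, fst h:] ^ i * [:snd z, snd h:] ^ j)) t =
      f (z + t *\<^sub>R h)"
proof -
  have "f w = (\<Sum>i\<le>n. \<Sum>j\<le>n. c i j * fst w ^ i * snd w ^ j)" for w
    using f[of "fst w" "snd w"] by (simp only: prod.collapse)
  then show ?thesis
    by (simp only: poly_sum poly_smult poly_mult poly_power poly_pCons poly_0 fst_add snd_add
        fst_scaleR snd_scaleR
        real_scaleR_def mult_zero_right add_0_right mult.assoc)
qed

lemma line_poly_expansion:
  assumes f: "\<And>x y. f (x, y) = (\<Sum>i\<le>n. \<Sum>j\<le>n. c i j * x ^ i * y ^ j)"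
  shows "line_poly f z h =
      (\<Sum>i\<le>n. \<Sum>j\<le>n. smult (c i j) ([:fst z, fst h:] ^ i * [:snd z, snd h:] ^ j))"
  by (rule line_poly_eqI) (rule poly_line_expansion[OF f])

lemma poly_line_poly:
  assumes "polyfun2 f" shows "poly (line_poly f z h) t = f (z + t *\<^sub>R h)"
proof -
  obtain n c where f: "\<And>x y. f (x, y) = (\<Sum>i\<le>n. \<Sum>j\<le>n. c i j * x ^ i * y ^ j)"
    using assms unfolding polyfun2_def by blast
  show ?thesis unfolding line_poly_expansion[OF f] by (rule poly_line_expansion[OF f])
qed

lemma degree_line_poly_bounded:
  assumes "polyfun2 f" obtains n where "\<And>z h. degree (line_poly f z h) \<le> n"
proof -
  obtain n c where f: "\<And>x y. f (x, y) = (\<Sum>i\<le>n. \<Sum>j\<le>n. c i j * x ^ i * y ^ j)"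
    using assms unfolding polyfun2_def by blast
  have degree_linear: "degree ([:a, b:] ^ i) \<le> i" for a b :: real and i
    using degree_power_le[of "[:a, b:]" i] by (auto split: if_splits)
  have deg: "degree (smult (c i j) ([:fst z, fst h:] ^ i * [:snd z, snd h:] ^ j)) \<le> 2 * n"
    if "i \<in> {..n}" "j \<in> {..n}" for i j z h
    using degree_smult_le[of "c i j" "[:fst z, fst h:] ^ i * [:snd z, snd h:] ^ j"]
      degree_mult_le[of "[:fst z, fst h:] ^ i" "[:snd z, snd h:] ^ j"]
      degree_linear[of "fst z" "fst h" i] degree_linear[of "snd z" "snd h" j] that
        unfolding atMost_iff by linarith
  have "degree (line_poly f z h) \<le> 2 * n" for z h
    unfolding line_poly_expansion[OF f] by (intro degree_sum_le finite_atMost deg)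
  then show ?thesis by (rule that)
qed

lemma polyfun2_coeff_linear_power:
  assumes "polyfun2 f" shows "polyfun2 (\<lambda>h. coeff ([:a, f h:] ^ i) s)"
proof (induction i arbitrary: s)
  case (Suc i)
  have coeff: "polyfun2 (\<lambda>h. coeff [:a, f h:] k)" for k
    using assms polyfun2_const by (cases "k = 0"; cases "k = 1") (simp_all add: coeff_pCons')
  show ?case unfolding power_Suc coeff_mult by (intro polyfun2_sum polyfun2_mult coeff Suc.IH)
qed (simp add: polyfun2_const)

lemma polyfun2_taylor_form [polyfun2_intros]:
  assumes "polyfun2 f" shows "polyfun2 (taylor_form f z s)"
proof -
  obtain n c where f: "\<And>x y. f (x, y) = (\<Sum>i\<le>n. \<Sum>j\<le>n. c i j * x ^ i * y ^ j)"
    using assms unfolding polyfun2_def by blast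
  show ?thesis
    unfolding taylor_form_def[abs_def] line_poly_expansion[OF f] coeff_sum coeff_smult coeff_mult
    by (intro polyfun2_sum polyfun2_mult polyfun2_const polyfun2_coeff_linear_power polyfun2_fst
        polyfun2_snd)
qed

lemma taylor_form_scaleR:
  assumes "polyfun2 f" shows "taylor_form f z s (c *\<^sub>R h) = c ^ s * taylor_form f z s h"
proof -
  have "line_poly f z (c *\<^sub>R h) = pcompose (line_poly f z h) [:0, c:]"
    by (rule line_poly_eqI) (simp add: poly_pcompose poly_line_poly[OF assms] mult.commute)
  then show ?thesis by (simp add: taylor_form_def coeff_pcompose_linear)
qed

lemma taylor_form_0: "polyfun2 f \<Longrightarrow> taylor_form f z 0 h = f z"
  using poly_line_poly[of f z h 0] by (simp add: taylor_form_def poly_0_coeff_0)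

lemma taylor_expansion:
  assumes "polyfun2 f"
  obtains n where "\<And>z h m. m \<ge> n \<Longrightarrow> f (z + h) = (\<Sum>s\<le>m. taylor_form f z s h)"
    "\<And>z s. s > n \<Longrightarrow> taylor_form f z s = (\<lambda>_. 0)"
proof -
  obtain n where n: "\<And>z h. degree (line_poly f z h) \<le> n"
    by (rule degree_line_poly_bounded[OF assms]) (rule that)
  show ?thesis
  proof (rule that[of n])
    fix z h m assume "m \<ge> n"
    then show "f (z + h) = (\<Sum>s\<le>m. taylor_form f z s h)"
      using poly_line_poly[OF assms, of z h 1] poly_eq_sum_le[OF order_trans[OF n], of m z h 1]
      by (simp add: taylor_form_def)
  next
    fix z s assume "s > n"
    then show "taylor_form f z s = (\<lambda>_. 0)"
      unfolding taylor_form_def by (intro ext coeff_eq_0 le_less_trans[OF n])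
  qed
qed

lemma homogeneous_vanishing_at:
  fixes F :: "'a::euclidean_space \<Rightarrow> real"
  assumes hom: "\<And>c h. F (c *\<^sub>R h) = c ^ s * F h" and cont: "continuous_on UNIV F"
  shows "(\<lambda>w. F (w - z)) \<in> vanishing_at z s"
proof -
  have "compact (F ` sphere 0 1)"
    by (intro compact_continuous_image continuous_on_subset[OF cont]) auto
  then obtain C where C: "\<forall>h\<in>sphere 0 1. \<bar>F h\<bar> \<le> C"
    using compact_imp_bounded[of "F ` sphere 0 1"] by (auto simp: bounded_iff simp del: mem_sphere)
  have "\<bar>F h\<bar> \<le> C * norm h ^ s" if "h \<noteq> 0" for h
  proof -
    have "F h = norm h ^ s * F (h /\<^sub>R norm h)" using hom[of "norm h" "h /\<^sub>R norm h"] that by simp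
    moreover have "norm h ^ s * \<bar>F (h /\<^sub>R norm h)\<bar> \<le> norm h ^ s * C"
      using C that by (intro mult_left_mono) auto
    ultimately show ?thesis by (simp add: abs_mult mult.commute)
  qed
  then show ?thesis by (intro bigoI[of _ C]) (auto simp: eventually_at_filter dist_norm)
qed

lemma homogeneous_definite_order_at:
  fixes F :: "'a::euclidean_space \<Rightarrow> real"
  assumes hom: "\<And>c h. F (c *\<^sub>R h) = c ^ s * F h" and cont: "continuous_on UNIV F"
    and nonzero: "\<And>h. h \<noteq> 0 \<Longrightarrow> F h \<noteq> 0"
  shows "(\<lambda>w. F (w - z)) \<in> definite_order_at z s"
proof
  have "sphere (0::'a) 1 \<noteq> {}" by simp
  moreover have "continuous_on (sphere 0 1) (\<lambda>h. \<bar>F h\<bar>)"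
    by (intro continuous_intros continuous_on_subset[OF cont]) auto
  ultimately obtain k where k: "k \<in> sphere 0 1" "\<forall>h\<in>sphere 0 1. \<bar>F k\<bar> \<le> \<bar>F h\<bar>"
    using continuous_attains_inf[OF compact_sphere] by blast
  have "\<bar>F k\<bar> * norm h ^ s \<le> \<bar>F h\<bar>" if "h \<noteq> 0" for h
  proof -
    have "F h = norm h ^ s * F (h /\<^sub>R norm h)" using hom[of "norm h" "h /\<^sub>R norm h"] that by simp
    moreover have "norm h ^ s * \<bar>F k\<bar> \<le> norm h ^ s * \<bar>F (h /\<^sub>R norm h)\<bar>"
      using k(2) that by (intro mult_left_mono) auto
    ultimately show ?thesis by (simp add: abs_mult mult.commute)
  qed
  then have "\<forall>\<^sub>F w in at z. \<bar>F k\<bar> * norm (dist w z ^ s) \<le> norm (F (w - z))"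
    by (simp add: eventually_at_filter dist_norm)
  moreover have "k \<noteq> 0" using k(1) by auto
  then have "\<bar>F k\<bar> > 0" using nonzero by simp
  ultimately show "(\<lambda>w. F (w - z)) \<in> \<Omega>[at z](\<lambda>w. dist w z ^ s)"
    unfolding bigomega_def by blast
qed (rule homogeneous_vanishing_at[of F, OF hom cont])

lemma taylor_form_vanishing_at:
  assumes "polyfun2 f"
  shows "(\<lambda>w. taylor_form f z s (w - z)) \<in> vanishing_at z s"
  by (rule homogeneous_vanishing_at[of "taylor_form f z s", OF taylor_form_scaleR[OF assms]
        continuous_on_polyfun2[OF polyfun2_taylor_form[OF assms]]])

lemma taylor_remainder_vanishing_at:
  assumes f: "polyfun2 f"
  shows "(\<lambda>w. f w - (\<Sum>s<m. taylor_form f z s (w - z))) \<in> vanishing_at z m"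
proof -
  obtain n where n: "\<And>z h m. m \<ge> n \<Longrightarrow> f (z + h) = (\<Sum>s\<le>m. taylor_form f z s h)"
    by (rule taylor_expansion[OF f]) (rule that)
  have "f w - (\<Sum>s<m. taylor_form f z s (w - z)) = (\<Sum>s\<in>{m..n+m}. taylor_form f z s (w - z))" for w
  proof -
    have "f w = (\<Sum>s\<le>n+m. taylor_form f z s (w - z))" using n[of "n + m" z "w - z"] by simp
    also have "{..n+m} = {..<m} \<union> {m..n+m}" by auto
    finally show ?thesis by (subst (asm) sum.union_disjoint) auto
  qed
  moreover have "(\<lambda>w. \<Sum>s\<in>{m..n+m}. taylor_form f z s (w - z)) \<in> vanishing_at z m"
    by (intro big_sum_in_bigo landau_o.big_trans[OF taylor_form_vanishing_at[OF f]
        vanishing_at_dist_power]) simp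
  ultimately show ?thesis by simp
qed

lemma filterlim_line:
  assumes "h \<noteq> (0::pt)" shows "filterlim (\<lambda>t. z + t *\<^sub>R h) (at z) (at (0::real))"
  unfolding filterlim_at
proof
  show "((\<lambda>t. z + t *\<^sub>R h) \<longlongrightarrow> z) (at 0)" by (auto intro!: tendsto_eq_intros)
  show "\<forall>\<^sub>F t in at 0. z + t *\<^sub>R h \<in> UNIV \<and> z + t *\<^sub>R h \<noteq> z"
    using assms by (simp add: eventually_at_filter)
qed

lemma smallo_line_poly:
  assumes f: "polyfun2 f" and o: "f \<in> o[at z](\<lambda>w. dist w z ^ m)" and "h \<noteq> 0"
  shows "poly (line_poly f z h) \<in> o[at 0](\<lambda>t. \<bar>t\<bar> ^ m)"
proof -
  have "(\<lambda>t. f (z + t *\<^sub>R h)) \<in> o[at 0](\<lambda>t. dist (z + t *\<^sub>R h) z ^ m)"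
    by (rule landau_o.small.compose[OF o filterlim_line[OF \<open>h \<noteq> 0\<close>]])
  moreover have "dist (z + t *\<^sub>R h) z ^ m = norm h ^ m * \<bar>t\<bar> ^ m" for t
    by (simp add: dist_norm power_mult_distrib)
  ultimately show ?thesis using \<open>h \<noteq> 0\<close> by (simp add: poly_line_poly[OF f, abs_def])
qed

lemma taylor_form_eq_0_of_smallo:
  assumes f: "polyfun2 f" and o: "f \<in> o[at z](\<lambda>w. dist w z ^ m)" and "s \<le> m"
  shows "taylor_form f z s = (\<lambda>_. 0)"
proof -
  have off_0: "taylor_form f z s h = 0" if "h \<noteq> 0" for h
    using smallo_line_poly[OF f o that] \<open>s \<le> m\<close> by (simp add: poly_smallo_at_0_iff taylor_form_def)
  have "taylor_form f z s 0 = 0 ^ s * taylor_form f z s (1, 0)"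
    using taylor_form_scaleR[OF f, of z s 0 "(1, 0)"] by (simp add: zero_prod_def)
  also have "taylor_form f z s (1, 0) = 0" by (rule off_0) (simp add: zero_prod_def)
  finally have "taylor_form f z s 0 = 0" by simp
  with off_0 show ?thesis by (intro ext) metis
qed

lemma vanishing_at_iff_taylor_form:
  assumes f: "polyfun2 f"
  shows "f \<in> vanishing_at z m \<longleftrightarrow> (\<forall>s<m. taylor_form f z s = (\<lambda>_. 0))"
proof (intro iffI allI impI)
  fix s assume "f \<in> vanishing_at z m" "s < m"
  then have "f \<in> o[at z](\<lambda>w. dist w z ^ s)"
    by (rule landau_o.big_small_trans[OF _ dist_power_smallo])
  then show "taylor_form f z s = (\<lambda>_. 0)" by (rule taylor_form_eq_0_of_smallo[OF f _ order_refl])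
next
  assume "\<forall>s<m. taylor_form f z s = (\<lambda>_. 0)"
  then show "f \<in> vanishing_at z m" using taylor_remainder_vanishing_at[OF f, of z m] by simp
qed

lemma vanishing_at_Suc_of_smallo:
  assumes "polyfun2 f" "f \<in> o[at z](\<lambda>w. dist w z ^ m)"
  shows "f \<in> vanishing_at z (Suc m)"
  unfolding vanishing_at_iff_taylor_form[OF assms(1)] using taylor_form_eq_0_of_smallo[OF assms]
  by simp

lemma definite_order_at_imp_taylor_form_nonzero:
  assumes f: "polyfun2 f" and order: "f \<in> definite_order_at z m" and h: "h \<noteq> 0"
  shows "taylor_form f z m h \<noteq> 0"
proof
  assume "taylor_form f z m h = 0"
  moreover have "\<forall>s<m. taylor_form f z s = (\<lambda>_. 0)"
    using order vanishing_at_iff_taylor_form[OF f] by blast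
  ultimately have "poly (line_poly f z h) \<in> o[at 0](\<lambda>t. \<bar>t\<bar> ^ m)"
    unfolding poly_smallo_at_0_iff taylor_form_def by (metis le_neq_implies_less)
  moreover have "(\<lambda>t. dist (z + t *\<^sub>R h) z ^ m) \<in> \<Theta>[at 0](\<lambda>t. f (z + t *\<^sub>R h))"
    using order by (subst bigtheta_sym) (rule landau_theta.compose[OF _ filterlim_line[OF h]])
  then have "(\<lambda>t. \<bar>t\<bar> ^ m) \<in> \<Theta>[at 0](poly (line_poly f z h))"
    using h by (simp add: poly_line_poly[OF f, abs_def] dist_norm power_mult_distrib)
  ultimately have "(\<lambda>t::real. \<bar>t\<bar> ^ m) \<in> o[at 0](\<lambda>t. \<bar>t\<bar> ^ m)"
    using landau_o.small.in_cong_bigtheta by blast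
  then show False using not_dist_power_smallo[of m m "0::real"] by (simp add: dist_real_def)
qed

lemma definite_order_atI:
  assumes f: "polyfun2 f" and van: "f \<in> vanishing_at z m"
    and nonzero: "\<And>h. h \<noteq> 0 \<Longrightarrow> taylor_form f z m h \<noteq> 0"
  shows "f \<in> definite_order_at z m"
proof -
  let ?H = "\<lambda>w. taylor_form f z m (w - z)"
  have H: "?H \<in> definite_order_at z m"
    using nonzero
    by (intro homogeneous_definite_order_at[of "taylor_form f z m", OF taylor_form_scaleR[OF f]
          continuous_on_polyfun2[OF polyfun2_taylor_form[OF f]]])
  have "(\<lambda>w. f w - ?H w) \<in> vanishing_at z (Suc m)"
    using taylor_remainder_vanishing_at[OF f, of z "Suc m"] van vanishing_at_iff_taylor_form[OF f]
    by simp
  also have "(\<lambda>w. dist w z ^ Suc m) \<in> o[at z](\<lambda>w. dist w z ^ m)" by (rule dist_power_smallo) simp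
  also have "(\<lambda>w. dist w z ^ m) \<in> \<Theta>[at z](?H)" using H by (simp add: bigtheta_sym)
  finally have "(\<lambda>w. ?H w + (f w - ?H w)) \<in> definite_order_at z m \<longleftrightarrow> ?H \<in> definite_order_at z m"
    by (subst (1 2) bigtheta_sym) (simp only: landau_theta.plus_absorb2)
  then show ?thesis using H by simp
qed

lemma taylor_form_mult_initial:
  assumes f: "polyfun2 f" "f \<in> vanishing_at z i" and g: "polyfun2 g" "g \<in> vanishing_at z j"
  shows "taylor_form (\<lambda>w. f w * g w) z (i + j) h = taylor_form f z i h * taylor_form g z j h"
proof -
  let ?p = "line_poly f z h" and ?q = "line_poly g z h"
  have coeff_p: "coeff ?p s = 0" if "s < i" for s
    using f(2) that unfolding vanishing_at_iff_taylor_form[OF f(1)] taylor_form_def by meson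
  have coeff_q: "coeff ?q s = 0" if "s < j" for s
    using g(2) that unfolding vanishing_at_iff_taylor_form[OF g(1)] taylor_form_def by meson
  have "line_poly (\<lambda>w. f w * g w) z h = ?p * ?q"
    by (rule line_poly_eqI) (simp add: poly_line_poly f g)
  then have "taylor_form (\<lambda>w. f w * g w) z (i + j) h =
      (\<Sum>s\<le>i + j. coeff ?p s * coeff ?q (i + j - s))"
    by (simp add: taylor_form_def coeff_mult)
  also have "\<dots> = (\<Sum>s\<in>{i}. coeff ?p s * coeff ?q (i + j - s))"
  proof (rule sum.mono_neutral_right)
    show "\<forall>s\<in>{..i + j} - {i}. coeff ?p s * coeff ?q (i + j - s) = 0"
    proof
      fix s assume "s \<in> {..i + j} - {i}"
      then have "s < i \<or> i + j - s < j" by auto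
      then show "coeff ?p s * coeff ?q (i + j - s) = 0" using coeff_p coeff_q by auto
    qed
  qed auto
  finally show ?thesis by (simp add: taylor_form_def)
qed

lemma exists_initial_form:
  assumes f: "polyfun2 f" "f \<noteq> (\<lambda>_. 0)"
  obtains m where "f \<in> vanishing_at z m" "taylor_form f z m \<noteq> (\<lambda>_. 0)"
proof -
  obtain n where n: "\<And>z h m. m \<ge> n \<Longrightarrow> f (z + h) = (\<Sum>s\<le>m. taylor_form f z s h)"
    by (rule taylor_expansion[OF f(1)]) (rule that)
  have "\<exists>m. taylor_form f z m \<noteq> (\<lambda>_. 0)"
  proof (rule ccontr)
    assume "\<nexists>m. taylor_form f z m \<noteq> (\<lambda>_. 0)"
    then have "f w = 0" for w using n[OF order_refl, of z "w - z"] by simp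
    with f(2) show False by blast
  qed
  then show ?thesis
    using that exists_least_iff[of "\<lambda>m. taylor_form f z m \<noteq> (\<lambda>_. 0)"]
        vanishing_at_iff_taylor_form[OF f(1)] by blast
qed

lemma vanishing_order_unique:
  assumes f: "polyfun2 f" "f \<in> definite_order_at z m" "f \<in> vanishing_at z n"
    "taylor_form f z n \<noteq> (\<lambda>_. 0)"
  shows "m = n"
proof (rule antisym)
  have "f \<in> vanishing_at z m" using f(2) by blast
  with f(4) show "m \<le> n" unfolding vanishing_at_iff_taylor_form[OF f(1)] by (metis not_le_imp_less)
  have "taylor_form f z m (1, 0) \<noteq> 0"
    by (rule definite_order_at_imp_taylor_form_nonzero[OF f(1,2)]) (simp add: zero_prod_def)
  with f(3) show "n \<le> m" unfolding vanishing_at_iff_taylor_form[OF f(1)] by (metis not_le_imp_less)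
qed

lemma polyfun2_eq_0_of_eventually:
  assumes f: "polyfun2 f" and "\<forall>\<^sub>F w in at z. f w = 0" shows "f = (\<lambda>_. 0)"
proof (rule ccontr)
  assume "f \<noteq> (\<lambda>_. 0)"
  then obtain m where m: "taylor_form f z m \<noteq> (\<lambda>_. 0)" by (rule exists_initial_form[OF f])
  have "f \<in> o[at z](\<lambda>w. dist w z ^ m)"
    using assms(2) by (subst landau_o.small.in_cong[where g = "\<lambda>_. 0"]) auto
  with m show False using taylor_form_eq_0_of_smallo[OF f _ order_refl] by blast
qed

lemma continuous_eq_off_zeros:
  assumes q: "polyfun2 q" "q \<noteq> (\<lambda>_. 0)" and "finite T"
    and cont: "continuous_on UNIV f" "continuous_on UNIV g"
    and eq: "\<And>w. w \<notin> T \<Longrightarrow> q w \<noteq> 0 \<Longrightarrow> f w = (g w :: real)"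
  shows "f z = g z"
proof (rule ccontr)
  assume "f z \<noteq> g z"
  moreover have "open {w. f w \<noteq> g w}" using cont by (intro open_Collect_neq)
  ultimately have "\<forall>\<^sub>F w in at z. f w \<noteq> g w"
    unfolding eventually_at_topological by blast
  moreover have "\<forall>\<^sub>F w in at z. w \<notin> T" using islimpt_finite[OF \<open>finite T\<close>, of z]
    by (simp add: islimpt_iff_eventually)
  ultimately have "\<forall>\<^sub>F w in at z. q w = 0" by eventually_elim (use eq in blast)
  then show False using polyfun2_eq_0_of_eventually q by blast
qed

lemma taylor_form_1:
  assumes f: "polyfun2 f" and der: "has_partials f a b z"
  shows "taylor_form f z 1 h = a * fst h + b * snd h"
proof -
  have "((\<lambda>t. f (z + t *\<^sub>R h)) has_derivative (\<lambda>t. (\<lambda>(h1, h2). a * h1 + b * h2) (t *\<^sub>R h))) (at 0)"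
  proof (rule has_derivative_compose[where g = f and f = "\<lambda>t. z + t *\<^sub>R h" and f' = "\<lambda>t. t *\<^sub>R h"])
    show "((\<lambda>t. z + t *\<^sub>R h) has_derivative (\<lambda>t. t *\<^sub>R h)) (at 0)"
      by (rule has_derivative_eq_rhs[OF has_derivative_add[OF has_derivative_const
              has_derivative_scaleR_left[OF has_derivative_ident]]]) simp
    show "has_partials f a b (z + 0 *\<^sub>R h)" using der by simp
  qed
  then have "(poly (line_poly f z h) has_field_derivative (a * fst h + b * snd h)) (at 0)"
    unfolding has_field_derivative_def poly_line_poly[OF f, abs_def]
    by (rule has_derivative_eq_rhs) (auto simp: case_prod_unfold algebra_simps)
  then have "poly (pderiv (line_poly f z h)) 0 = a * fst h + b * snd h"
    by (rule DERIV_unique[OF poly_DERIV])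
  then show ?thesis by (simp add: taylor_form_def poly_0_coeff_0 coeff_pderiv)
qed

lemma has_partials_compose_affine:
  assumes "has_partials f a b (z + t *\<^sub>R h)"
  shows "has_partials (\<lambda>h. f (z + t *\<^sub>R h)) (t * a) (t * b) h"
proof -
  have "((\<lambda>h. z + t *\<^sub>R h) has_derivative (\<lambda>k. t *\<^sub>R k)) (at h)"
    by (auto intro!: derivative_eq_intros)
  from has_derivative_compose[OF this assms] show ?thesis
    by (rule has_derivative_eq_rhs) (auto simp: algebra_simps)
qed

lemma has_partials_power_sum:
  assumes "\<And>k. has_partials (F k) (a k) (b k) h"
  shows "has_partials (\<lambda>h. \<Sum>k\<le>N. t ^ k * F k h) (\<Sum>k\<le>N. t ^ k * a k) (\<Sum>k\<le>N. t ^ k * b k) h"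
  by (rule has_derivative_eq_rhs[OF has_derivative_sum[OF has_derivative_mult_right[OF assms]]])
    (simp add: fun_eq_iff sum_distrib_left sum.distrib distrib_left mult_ac)

lemma taylor_form_has_partials:
  assumes f: "polyfun2 f" "polyfun2 f1" "polyfun2 f2" and der: "\<And>w. has_partials f (f1 w) (f2 w) w"
  shows "has_partials (taylor_form f z (Suc s)) (taylor_form f1 z s h) (taylor_form f2 z s h) h"
proof -
  obtain n where n: "\<And>z h m. m \<ge> n \<Longrightarrow> f (z + h) = (\<Sum>s\<le>m. taylor_form f z s h)"
    by (rule taylor_expansion[OF f(1)]) (rule that)
  define N where "N = n + Suc s"
  have "\<exists>a b. has_partials (taylor_form f z k) a b h" for k
    using polyfun2_has_partials[OF polyfun2_taylor_form[OF f(1)]] by metis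
  then obtain a b where ab: "\<And>k. has_partials (taylor_form f z k) (a k) (b k) h" by metis
  have "t * f1 (z + t *\<^sub>R h) = (\<Sum>k\<le>N. t ^ k * a k) \<and> t * f2 (z + t *\<^sub>R h) = (\<Sum>k\<le>N. t ^ k * b k)" for t
  proof -
    have "f (z + t *\<^sub>R h) = (\<Sum>k\<le>N. t ^ k * taylor_form f z k h)" for h
      using n[of N z "t *\<^sub>R h"] by (simp add: taylor_form_scaleR[OF f(1)] N_def)
    then have "has_partials (\<lambda>h. f (z + t *\<^sub>R h)) (\<Sum>k\<le>N. t ^ k * a k) (\<Sum>k\<le>N. t ^ k * b k) h"
      using has_partials_power_sum[of "taylor_form f z", OF ab] by simp
    with has_partials_compose_affine[OF der] show ?thesis using has_partials_unique by blast
  qed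
  then have "[:0, 1:] * line_poly f1 z h = (\<Sum>k\<le>N. monom (a k) k)"
    "[:0, 1:] * line_poly f2 z h = (\<Sum>k\<le>N. monom (b k) k)"
    by (auto simp: poly_line_poly f poly_sum poly_monom mult.commute fun_eq_iff
        simp flip: poly_eq_poly_eq_iff)
  from arg_cong[OF this(1), of "\<lambda>p. coeff p (Suc s)"] arg_cong[OF this(2), of "\<lambda>p. coeff p (Suc s)"]
  have "taylor_form f1 z s h = a (Suc s)" "taylor_form f2 z s h = b (Suc s)"
    by (simp_all add: taylor_form_def coeff_sum N_def)
  then show ?thesis using ab by simp
qed

lemma vanishing_at_partials:
  assumes f: "polyfun2 f" "polyfun2 f1" "polyfun2 f2" and der: "\<And>w. has_partials f (f1 w) (f2 w) w"
    and "f \<in> vanishing_at z (Suc m)"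
  shows "f1 \<in> vanishing_at z m" "f2 \<in> vanishing_at z m"
proof -
  have "taylor_form f1 z s h = 0 \<and> taylor_form f2 z s h = 0" if "s < m" for s h
  proof -
    have "taylor_form f z (Suc s) = (\<lambda>_. 0)" using assms(5) that
      unfolding vanishing_at_iff_taylor_form[OF f(1)] by simp
    then have "has_partials (\<lambda>_. 0) (taylor_form f1 z s h) (taylor_form f2 z s h) h"
      using taylor_form_has_partials[OF f der, of z s h] by simp
    moreover have "has_partials (\<lambda>_. 0) 0 0 h" by (auto simp: case_prod_unfold)
    ultimately show ?thesis using has_partials_unique by blast
  qed
  then show "f1 \<in> vanishing_at z m" "f2 \<in> vanishing_at z m"
    by (auto simp: vanishing_at_iff_taylor_form f)
qed

section \<open>Definite polynomials\<close>

text \<open>For a polynomial \<open>f\<close> this says that the initial form of \<open>f\<close> at \<open>z\<close> has no nontrivial real zero;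
  equivalently, the strict transform of \<open>f\<close> does not meet the exceptional curve over \<open>z\<close>.\<close>
definition definite_at :: "pt \<Rightarrow> (pt \<Rightarrow> real) \<Rightarrow> bool" where
  "definite_at z f \<longleftrightarrow> (\<exists>m. f \<in> definite_order_at z m)"

definition definite_poly :: "(pt \<Rightarrow> real) \<Rightarrow> bool" where
  "definite_poly f \<longleftrightarrow> polyfun2 f \<and> (\<forall>z. definite_at z f)"

lemma definite_atI: "f \<in> definite_order_at z m \<Longrightarrow> definite_at z f"
  unfolding definite_at_def by blast

lemma definite_atE:
  assumes "definite_at z f" obtains m where "f \<in> definite_order_at z m"
  using assms unfolding definite_at_def by blast

lemma definite_polyD: "definite_poly f \<Longrightarrow> polyfun2 f" "definite_poly f \<Longrightarrow> definite_at z f"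
  unfolding definite_poly_def by blast+

lemma isCont_bigtheta_1:
  assumes "isCont f z" "f z \<noteq> (0::real)" shows "f \<in> \<Theta>[at z](\<lambda>_. 1)"
  using assms by (intro bigthetaI_tendsto[of "f z"]) (auto simp: isCont_def)

lemma isCont_bigo_1: "isCont f z \<Longrightarrow> f \<in> O[at z](\<lambda>_. 1 :: real)"
  by (rule bigoI_tendsto[of _ _ "f z"]) (auto simp: isCont_def)

lemma definite_at_nonzero: "isCont f z \<Longrightarrow> f z \<noteq> 0 \<Longrightarrow> definite_at z f"
  by (rule definite_atI[of f z 0]) (simp add: isCont_bigtheta_1)

lemma definite_at_mult:
  assumes "definite_at z f" "definite_at z g" shows "definite_at z (\<lambda>w. f w * g w)"
proof -
  obtain m where m: "f \<in> definite_order_at z m" by (rule definite_atE[OF assms(1)])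
  obtain n where n: "g \<in> definite_order_at z n" by (rule definite_atE[OF assms(2)])
  have "(\<lambda>w. f w * g w) \<in> definite_order_at z (m + n)"
    unfolding power_add by (rule landau_theta.mult[OF m n])
  then show ?thesis by (rule definite_atI)
qed

lemma definite_at_eventually_nonzero:
  assumes "definite_at z f" shows "\<forall>\<^sub>F w in at z. f w \<noteq> 0"
proof -
  obtain m where m: "f \<in> definite_order_at z m" by (rule definite_atE[OF assms])
  have "\<forall>\<^sub>F w in at z. dist w z ^ m \<noteq> 0" using eventually_dist_nonzero_at by eventually_elim simp
  with eventually_nonzero_bigtheta[OF m] show ?thesis by blast
qed

lemma definite_at_imp_nonzero: "definite_at z f \<Longrightarrow> f \<noteq> (\<lambda>_. 0)"
  using definite_at_eventually_nonzero[of z f] by auto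

lemma definite_at_factor:
  assumes f: "polyfun2 f" and g: "polyfun2 g" and fg: "definite_at z (\<lambda>w. f w * g w)"
  shows "definite_at z f"
proof -
  let ?fg = "\<lambda>w. f w * g w"
  have fg_poly: "polyfun2 ?fg" by (rule polyfun2_mult[OF f g])
  obtain m where m: "?fg \<in> definite_order_at z m" by (rule definite_atE[OF fg])
  have "f \<noteq> (\<lambda>_. 0)" using definite_at_imp_nonzero[OF fg] by auto
  then obtain i where i: "f \<in> vanishing_at z i" "taylor_form f z i \<noteq> (\<lambda>_. 0)"
    by (rule exists_initial_form[OF f])
  have "g \<noteq> (\<lambda>_. 0)" using definite_at_imp_nonzero[OF fg] by auto
  then obtain j where j: "g \<in> vanishing_at z j" "taylor_form g z j \<noteq> (\<lambda>_. 0)"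
    by (rule exists_initial_form[OF g])
  note form = taylor_form_mult_initial[OF f i(1) g j(1)]
  have "taylor_form ?fg z (i + j) \<noteq> (\<lambda>_. 0)"
  proof
    assume "taylor_form ?fg z (i + j) = (\<lambda>_. 0)"
    then have "taylor_form f z i h * taylor_form g z j h = 0" for h using form[of h] by simp
    then show False
      using polyfun2_mult_eq_0[OF polyfun2_taylor_form[OF f] polyfun2_taylor_form[OF g]] i(2) j(2)
      by blast
  qed
  moreover have "?fg \<in> vanishing_at z (i + j)" unfolding power_add
    by (rule landau_o.big.mult[OF i(1) j(1)])
  ultimately have "m = i + j" using vanishing_order_unique[OF fg_poly m] by blast
  then have "taylor_form f z i h \<noteq> 0" if "h \<noteq> 0" for h
    using definite_order_at_imp_taylor_form_nonzero[OF fg_poly m that] form[of h] by simp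
  then show ?thesis by (rule definite_atI[OF definite_order_atI[OF f i(1)]])
qed

lemma bounded_definite_order_at:
  assumes f: "polyfun2 f"
  obtains n where "\<And>z m. f \<in> definite_order_at z m \<Longrightarrow> m \<le> n"
proof -
  obtain n where n: "\<And>z s. s > n \<Longrightarrow> taylor_form f z s = (\<lambda>_. 0)"
    by (rule taylor_expansion[OF f]) (rule that)
  have "m \<le> n" if "f \<in> definite_order_at z m" for z m
  proof -
    have "taylor_form f z m (1, 0) \<noteq> 0"
      by (rule definite_order_at_imp_taylor_form_nonzero[OF f that]) (simp add: zero_prod_def)
    then show ?thesis using n[of m z] by (cases "m \<le> n") auto
  qed
  then show ?thesis by (rule that)
qed

lemma definite_zero_critical:
  assumes f: "polyfun2 f" and "definite_at z f" "f z = 0" and der: "has_partials f a b z"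
  shows "a = 0" "b = 0"
proof -
  obtain m where m: "f \<in> definite_order_at z m" by (rule definite_atE[OF assms(2)])
  note form = definite_order_at_imp_taylor_form_nonzero[OF f m]
  have form1: "taylor_form f z 1 h = a * fst h + b * snd h" for h by (rule taylor_form_1[OF f der])
  have "a = 0 \<and> b = 0"
  proof (cases "m > 1")
    case True
    moreover have "f \<in> vanishing_at z m" using m by blast
    ultimately have "taylor_form f z 1 = (\<lambda>_. 0)" by (simp add: vanishing_at_iff_taylor_form f)
    then show ?thesis using form1[of "(1, 0)"] form1[of "(0, 1)"] by simp
  next
    case False
    have "m \<noteq> 0" using form[of "(1, 0)"] taylor_form_0[OF f, of z "(1, 0)"] \<open>f z = 0\<close>
      by (intro notI) (simp add: zero_prod_def)
    then have "m = 1" using False by simp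
    then have "(b, - a) = 0" using form[of "(b, - a)"] form1[of "(b, - a)"]
      by (cases "(b, - a) = 0") auto
    then show ?thesis by (simp add: zero_prod_def)
  qed
  then show "a = 0" "b = 0" by simp_all
qed

lemma degree_0_imp_not_definite_zero:
  assumes "degree p = 0" "poly2 p z = 0" shows "\<not> definite_at z (poly2 p)"
proof
  obtain r where p: "p = [:r:]" using degree_eq_zeroE[OF assms(1)] .
  have "line_poly (poly2 p) z (1, 0) = 0" by (rule line_poly_eqI) (use assms(2) in \<open>simp add: p\<close>)
  then have "taylor_form (poly2 p) z m (1, 0) = 0" for m by (simp add: taylor_form_def)
  moreover assume "definite_at z (poly2 p)"
  then obtain m where "poly2 p \<in> definite_order_at z m" by (rule definite_atE)
  then have "taylor_form (poly2 p) z m (1, 0) \<noteq> 0"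
    by (rule definite_order_at_imp_taylor_form_nonzero[OF polyfun2_poly2]) (simp add: zero_prod_def)
  ultimately show False by blast
qed

lemma finite_definite_zeros_prime_elem:
  fixes p :: "real poly poly"
  assumes "prime_elem p" shows "finite {z. poly2 p z = 0 \<and> definite_at z (poly2 p)}"
proof (cases "degree p = 0")
  case True
  then have "{z. poly2 p z = 0 \<and> definite_at z (poly2 p)} = {}"
    using degree_0_imp_not_definite_zero by blast
  then show ?thesis by (simp only: finite.emptyI)
next
  case False
  have "\<not> p dvd pderiv p"
  proof
    assume "p dvd pderiv p"
    moreover have "pderiv p \<noteq> 0" using False by (simp add: pderiv_eq_0_iff)
    ultimately have "degree p \<le> degree (pderiv p)" by (rule dvd_imp_degree_le)
    then show False using False by (simp add: degree_pderiv)
  qed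
  then have "coprime p (pderiv p)" by (rule prime_elem_imp_coprime[OF assms])
  then have "finite {z. poly2 p z = 0 \<and> poly2 (pderiv p) z = 0}" by (rule finite_common_zeros)
  moreover have "{z. poly2 p z = 0 \<and> definite_at z (poly2 p)} \<subseteq>
      {z. poly2 p z = 0 \<and> poly2 (pderiv p) z = 0}"
    using definite_zero_critical(1)[OF polyfun2_poly2 _ _ has_partials_poly2] by blast
  ultimately show ?thesis by (rule finite_subset[rotated])
qed

lemma finite_definite_zeros:
  assumes "polyfun2 f" shows "finite {z. f z = 0 \<and> definite_at z f}"
proof -
  obtain p where f: "f = poly2 p" using assms by (rule polyfun2E)
  have "finite {z. poly2 p z = 0 \<and> definite_at z (poly2 p)}"
  proof (induction p rule: prime_divisors_induct)
    case zero
    have "{z. poly2 0 z = (0::real) \<and> definite_at z (poly2 0)} = {}"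
      using definite_at_imp_nonzero poly2_eq_0_iff by blast
    then show ?case by (simp only: finite.emptyI)
  next
    case (unit p)
    then obtain q where "p * q = 1" by (metis dvdE)
    then have "poly2 p z \<noteq> 0" for z by (metis poly2_simps(2,5) mult_zero_left zero_neq_one)
    then show ?case by simp
  next
    case (factor q p)
    have "{z. poly2 (q * p) z = 0 \<and> definite_at z (poly2 (q * p))} \<subseteq>
        {z. poly2 q z = 0 \<and> definite_at z (poly2 q)} \<union> {z. poly2 p z = 0 \<and> definite_at z (poly2 p)}"
    proof
      fix z assume z: "z \<in> {z. poly2 (q * p) z = 0 \<and> definite_at z (poly2 (q * p))}"
      then have "definite_at z (\<lambda>w. poly2 q w * poly2 p w)"
        "definite_at z (\<lambda>w. poly2 p w * poly2 q w)"
        by (simp_all add: poly2_simps(5)[abs_def] mult.commute)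
      then have "definite_at z (poly2 q)" "definite_at z (poly2 p)"
        using definite_at_factor polyfun2_poly2 by blast+
      with z show "z \<in> {z. poly2 q z = 0 \<and> definite_at z (poly2 q)} \<union>
          {z. poly2 p z = 0 \<and> definite_at z (poly2 p)}"
        by auto
    qed
    moreover have "finite {z. poly2 q z = 0 \<and> definite_at z (poly2 q)}"
      using factor.hyps by (intro finite_definite_zeros_prime_elem) (simp add: prime_def)
    ultimately show ?case using factor.IH finite_subset by blast
  qed
  then show ?thesis by (simp add: f)
qed

lemma definite_poly_mult: "definite_poly f \<Longrightarrow> definite_poly g \<Longrightarrow> definite_poly (\<lambda>z. f z * g z)"
  by (simp add: definite_poly_def definite_at_mult polyfun2_mult)

lemma definite_poly_1: "definite_poly (\<lambda>z. 1)"
  by (simp add: definite_poly_def definite_at_nonzero polyfun2_const)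

lemma definite_poly_power: "definite_poly f \<Longrightarrow> definite_poly (\<lambda>z. f z ^ n)"
  by (induction n) (simp_all add: definite_poly_1 definite_poly_mult)

lemma definite_poly_neq_0: "definite_poly f \<Longrightarrow> f \<noteq> (\<lambda>_. 0)"
  using definite_at_imp_nonzero definite_polyD(2) by blast

lemma finite_zeros_definite_poly: "definite_poly f \<Longrightarrow> finite {z. f z = 0}"
  using finite_definite_zeros[OF definite_polyD(1)] by (simp add: definite_polyD(2))

lemma rsquarefree_root_factor:
  fixes p :: "'a::idom poly"
  assumes "rsquarefree p" "poly p r = 0"
  obtains e where "p = [:- r, 1:] * e" "poly e r \<noteq> 0"
proof -
  have "p \<noteq> 0" using assms(1) by (simp add: rsquarefree_def)
  then show ?thesis
    using that order_decomp[of p r] rsquarefree_root_order[OF assms]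
    by (auto simp: dvd_iff_poly_eq_0)
qed

text \<open>
  The initial form is \<open>a\<^sup>2\<^sup>n x\<^sup>2\<^sup>n + b\<^sup>2\<^sup>n y\<^sup>2\<^sup>n\<close> with \<open>a, b\<close> the values of \<open>p, q\<close> at the coordinates of \<open>z\<close>.
\<close>
lemma definite_at_sum_even_powers:
  assumes "poly p (fst z) \<noteq> 0" "poly q (snd z) \<noteq> 0"
  shows "definite_at z (\<lambda>w. poly ([:- fst z, 1:] * p) (fst w) ^ (2 * n) +
      poly ([:- snd z, 1:] * q) (snd w) ^ (2 * n))"
    (is "definite_at z ?f")
proof -
  have f: "polyfun2 ?f" by (intro polyfun2_intros)
  let ?F = "\<lambda>h. smult (fst h ^ (2 * n)) (pcompose p [:fst z, fst h:] ^ (2 * n)) +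
    smult (snd h ^ (2 * n)) (pcompose q [:snd z, snd h:] ^ (2 * n))"
  have "line_poly ?f z h = monom 1 (2 * n) * ?F h" for h
    by (rule line_poly_eqI) (simp add: poly_monom poly_pcompose power_mult_distrib algebra_simps)
  then have form: "taylor_form ?f z s h = (if s < 2 * n then 0 else coeff (?F h) (s - 2 * n))"
    for s h
    by (simp add: taylor_form_def coeff_monom_mult not_less)
  have "?f \<in> definite_order_at z (2 * n)"
  proof (rule definite_order_atI[OF f])
    have "taylor_form ?f z s = (\<lambda>_. 0)" if "s < 2 * n" for s using that
      by (intro ext) (simp only: form if_True)
    then show "?f \<in> vanishing_at z (2 * n)" unfolding vanishing_at_iff_taylor_form[OF f] by blast
    fix h :: pt assume "h \<noteq> 0"
    then have "fst h * poly p (fst z) \<noteq> 0 \<or> snd h * poly q (snd z) \<noteq> 0" using assms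
      by (auto simp: prod_eq_iff)
    then have "(fst h * poly p (fst z)) ^ (2 * n) + (snd h * poly q (snd z)) ^ (2 * n) > 0"
      by (auto intro: add_pos_nonneg add_nonneg_pos simp: zero_less_power_eq)
    moreover have "taylor_form ?f z (2 * n) h =
        (fst h * poly p (fst z)) ^ (2 * n) + (snd h * poly q (snd z)) ^ (2 * n)"
      unfolding form by (simp flip: poly_0_coeff_0 add: poly_pcompose power_mult_distrib)
    ultimately show "taylor_form ?f z (2 * n) h \<noteq> 0" by simp
  qed
  then show ?thesis by (rule definite_atI)
qed

lemma definite_poly_sum_even_powers:
  assumes uv: "rsquarefree u" "rsquarefree v"
  shows "definite_poly (\<lambda>z. poly u (fst z) ^ (2 * n) + poly v (snd z) ^ (2 * n))"
    (is "definite_poly ?f")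
proof -
  have f: "polyfun2 ?f" by (intro polyfun2_intros)
  have "definite_at z ?f" for z
  proof (cases "poly u (fst z) = 0 \<and> poly v (snd z) = 0")
    case True
    obtain p where p: "u = [:- fst z, 1:] * p" "poly p (fst z) \<noteq> 0"
      by (rule rsquarefree_root_factor[OF uv(1)]) (use True in \<open>auto intro: that\<close>)
    obtain q where q: "v = [:- snd z, 1:] * q" "poly q (snd z) \<noteq> 0"
      by (rule rsquarefree_root_factor[OF uv(2)]) (use True in \<open>auto intro: that\<close>)
    show ?thesis unfolding p(1) q(1) by (rule definite_at_sum_even_powers[OF p(2) q(2)])
  next
    case False
    then have "?f z > 0"
      by (auto intro: add_pos_nonneg add_nonneg_pos simp: zero_less_power_eq)
    then show ?thesis by (intro definite_at_nonzero isCont_polyfun2 f) simp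
  qed
  with f show ?thesis by (simp add: definite_poly_def)
qed

lemma ideal_definite_mult_Gcd:
  fixes J :: "real poly poly set"
  assumes J: "ring_ideal J" obtains D where "definite_poly (poly2 D)" "D * Gcd J \<in> J"
proof (cases "J \<subseteq> {0}")
  case True
  then have "Gcd J = 0" by (simp only: Gcd_0_iff)
  then have "1 * Gcd J \<in> J" using ring_ideal_0[OF J] by (simp only: mult_1)
  moreover have "definite_poly (poly2 1)" using definite_poly_1
    by (simp add: poly2_simps(2)[abs_def])
  ultimately show ?thesis using that by blast
next
  case False
  then obtain c c' where c: "c \<noteq> 0" "[:c:] * Gcd J \<in> J"
    and c': "c' \<noteq> 0" "swap_vars [:c':] * Gcd J \<in> J"
    by (rule ideal_univariate_mult_Gcd[OF J])
  obtain v m where v: "rsquarefree v" "c dvd v ^ m" by (rule dvd_power_of_rsquarefree[OF c(1)])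
  obtain u n where u: "rsquarefree u" "c' dvd u ^ n" by (rule dvd_power_of_rsquarefree[OF c'(1)])
  define N where "N = 2 * (m + n)"
  have "v ^ m dvd v ^ N" "u ^ n dvd u ^ N" by (simp_all add: N_def le_imp_power_dvd)
  then obtain a b where a: "v ^ N = c * a" and b: "u ^ N = c' * b"
    using u(2) v(2) by (metis dvd_trans dvdE)
  define D where "D = swap_vars [:u ^ N:] + [:v ^ N:]"
  have "poly2 D = (\<lambda>z. poly u (fst z) ^ N + poly v (snd z) ^ N)" by (auto simp: D_def)
  then have "definite_poly (poly2 D)"
    using definite_poly_sum_even_powers[OF u(1) v(1), of "m + n"] by (simp only: N_def)
  moreover have "D = swap_vars [:b:] * swap_vars [:c':] + [:a:] * [:c:]"
    by (simp add: D_def a b mult.commute flip: swap_vars_mult)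
  then have "D * Gcd J = swap_vars [:b:] * (swap_vars [:c':] * Gcd J) + [:a:] * ([:c:] * Gcd J)"
    by (simp only: distrib_right mult.assoc)
  then have "D * Gcd J \<in> J" by (simp only: ring_ideal_add[OF J] ring_ideal_mult[OF J] c(2) c'(2))
  ultimately show ?thesis by (rule that)
qed

section \<open>Local differentiability classes\<close>

fun CkOn :: "nat \<Rightarrow> pt set \<Rightarrow> (pt \<Rightarrow> real) \<Rightarrow> bool" where
  "CkOn 0 U f = continuous_on U f"
| "CkOn (Suc n) U f = (\<exists>f1 f2. (\<forall>z\<in>U. has_partials f (f1 z) (f2 z) z) \<and> CkOn n U f1 \<and> CkOn n U f2)"

lemma CkOn_UNIV: "CkOn k UNIV f \<longleftrightarrow> Ck k f"
  by (induction k arbitrary: f) auto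

lemma CkOn_SucI:
  "(\<And>z. z \<in> U \<Longrightarrow> has_partials f (f1 z) (f2 z) z) \<Longrightarrow> CkOn k U f1 \<Longrightarrow> CkOn k U f2 \<Longrightarrow> CkOn (Suc k) U f"
  unfolding CkOn.simps by blast

lemma CkOn_SucE:
  assumes "CkOn (Suc k) U f"
  obtains f1 f2 where "\<And>z. z \<in> U \<Longrightarrow> has_partials f (f1 z) (f2 z) z" "CkOn k U f1" "CkOn k U f2"
  using assms unfolding CkOn.simps by blast

lemma CkOn_subset: "CkOn k U f \<Longrightarrow> V \<subseteq> U \<Longrightarrow> CkOn k V f"
proof (induction k arbitrary: f)
  case (Suc k)
  from Suc.prems(1) obtain f1 f2 where
    f: "\<And>z. z \<in> U \<Longrightarrow> has_partials f (f1 z) (f2 z) z" "CkOn k U f1" "CkOn k U f2"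
      by (rule CkOn_SucE) blast
  show ?case using f(1) Suc.prems(2)
    by (intro CkOn_SucI[OF _ Suc.IH[OF f(2)] Suc.IH[OF f(3)]]) blast+
qed (auto intro: continuous_on_subset)

lemma CkOn_cong:
  assumes "CkOn k U f" "open U" "\<And>z. z \<in> U \<Longrightarrow> f z = g z" shows "CkOn k U g"
proof (cases k)
  case 0 then show ?thesis using assms continuous_on_cong[of U U f g] by auto
next
  case (Suc n)
  then obtain f1 f2 where
    f: "\<And>z. z \<in> U \<Longrightarrow> has_partials f (f1 z) (f2 z) z" "CkOn n U f1" "CkOn n U f2"
    using assms(1) CkOn_SucE by blast
  have "has_partials g (f1 z) (f2 z) z" if "z \<in> U" for z
    by (rule has_derivative_transform_within_open[OF f(1)[OF that] assms(2) that assms(3)])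
  then show ?thesis unfolding Suc using f(2,3) by (rule CkOn_SucI)
qed

lemma CkOn_imp_continuous_on:
  assumes "CkOn k U f" shows "continuous_on U f"
proof (cases k)
  case (Suc n)
  then obtain f1 f2 where "\<And>z. z \<in> U \<Longrightarrow> has_partials f (f1 z) (f2 z) z"
    using assms CkOn_SucE by blast
  then show ?thesis using has_derivative_continuous continuous_at_imp_continuous_on by blast
qed (use assms in simp)

lemma CkOn_Suc_imp: "CkOn (Suc k) U f \<Longrightarrow> CkOn k U f"
proof (induction k arbitrary: f)
  case 0 then show ?case unfolding CkOn.simps(1) by (rule CkOn_imp_continuous_on)
next
  case (Suc k)
  from Suc.prems obtain f1 f2 where
    f: "\<And>z. z \<in> U \<Longrightarrow> has_partials f (f1 z) (f2 z) z" "CkOn (Suc k) U f1" "CkOn (Suc k) U f2"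
      by (rule CkOn_SucE) blast
  show ?case by (rule CkOn_SucI[OF f(1) Suc.IH[OF f(2)] Suc.IH[OF f(3)]])
qed

lemma CkOn_polyfun2: "polyfun2 p \<Longrightarrow> CkOn k U p"
proof (induction k arbitrary: p)
  case 0 then show ?case by (simp add: continuous_on_polyfun2)
next
  case (Suc k)
  from Suc.prems obtain p1 p2 where "polyfun2 p1" "polyfun2 p2" "\<And>z. has_partials p (p1 z) (p2 z) z"
    by (rule polyfun2_has_partials) (rule that)
  then show ?case by (intro CkOn_SucI Suc.IH)
qed

lemma has_partials_mult:
  assumes "has_partials f a b z" "has_partials g c d z"
  shows "has_partials (\<lambda>w. f w * g w) (f z * c + a * g z) (f z * d + b * g z) z"
  by (rule has_derivative_eq_rhs[OF has_derivative_mult[OF assms]]) (auto simp: algebra_simps)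

lemma has_partials_divide:
  assumes "has_partials f a b z" "has_partials g c d z" "g z \<noteq> 0"
  shows "has_partials (\<lambda>w. f w / g w)
    ((a * g z - f z * c) / (g z * g z)) ((b * g z - f z * d) / (g z * g z)) z"
  by (rule has_derivative_eq_rhs[OF has_derivative_divide'[OF assms]])
    (auto simp: field_simps assms(3))

lemma CkOn_add: "CkOn k U f \<Longrightarrow> CkOn k U g \<Longrightarrow> CkOn k U (\<lambda>z. f z + g z)"
proof (induction k arbitrary: f g)
  case (Suc k)
  from Suc.prems(1) obtain f1 f2 where
    f: "\<And>z. z \<in> U \<Longrightarrow> has_partials f (f1 z) (f2 z) z" "CkOn k U f1" "CkOn k U f2"
      by (rule CkOn_SucE) blast
  from Suc.prems(2) obtain g1 g2 where
    g: "\<And>z. z \<in> U \<Longrightarrow> has_partials g (g1 z) (g2 z) z" "CkOn k U g1" "CkOn k U g2"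
      by (rule CkOn_SucE) blast
  have "has_partials (\<lambda>z. f z + g z) (f1 z + g1 z) (f2 z + g2 z) z" if "z \<in> U" for z
    by (rule has_derivative_eq_rhs[OF has_derivative_add[OF f(1)[OF that] g(1)[OF that]]])
      (auto simp: algebra_simps)
  then show ?case using Suc.IH[OF f(2) g(2)] Suc.IH[OF f(3) g(3)] by (rule CkOn_SucI)
qed (auto intro: continuous_intros)

lemma CkOn_mult: "CkOn k U f \<Longrightarrow> CkOn k U g \<Longrightarrow> CkOn k U (\<lambda>z. f z * g z)"
proof (induction k arbitrary: f g)
  case (Suc k)
  from Suc.prems(1) obtain f1 f2 where
    f: "\<And>z. z \<in> U \<Longrightarrow> has_partials f (f1 z) (f2 z) z" "CkOn k U f1" "CkOn k U f2"
      by (rule CkOn_SucE) blast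
  from Suc.prems(2) obtain g1 g2 where
    g: "\<And>z. z \<in> U \<Longrightarrow> has_partials g (g1 z) (g2 z) z" "CkOn k U g1" "CkOn k U g2"
      by (rule CkOn_SucE) blast
  show ?case
  proof (rule CkOn_SucI)
    show "has_partials (\<lambda>z. f z * g z) (f z * g1 z + f1 z * g z) (f z * g2 z + f2 z * g z) z"
      if "z \<in> U" for z
      by (rule has_partials_mult[OF f(1)[OF that] g(1)[OF that]])
    show "CkOn k U (\<lambda>z. f z * g1 z + f1 z * g z)" "CkOn k U (\<lambda>z. f z * g2 z + f2 z * g z)"
      by (intro CkOn_add Suc.IH Suc.prems[THEN CkOn_Suc_imp] f(2,3) g(2,3))+
  qed
qed (auto intro: continuous_intros)

lemma CkOn_power: "CkOn k U f \<Longrightarrow> CkOn k U (\<lambda>z. f z ^ n)"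
  by (induction n) (auto intro: CkOn_mult CkOn_polyfun2 polyfun2_const)

lemma CkOn_inverse: "CkOn k U f \<Longrightarrow> (\<And>z. z \<in> U \<Longrightarrow> f z \<noteq> 0) \<Longrightarrow> CkOn k U (\<lambda>z. 1 / f z)"
proof (induction k arbitrary: f)
  case 0 then show ?case unfolding CkOn.simps
    by (intro continuous_on_divide continuous_on_const) auto
next
  case (Suc k)
  from Suc.prems(1) obtain f1 f2 where
    f: "\<And>z. z \<in> U \<Longrightarrow> has_partials f (f1 z) (f2 z) z" "CkOn k U f1" "CkOn k U f2"
      by (rule CkOn_SucE) blast
  have inv: "CkOn k U (\<lambda>z. 1 / f z)" by (rule Suc.IH[OF CkOn_Suc_imp[OF Suc.prems(1)] Suc.prems(2)])
  show ?case
  proof (rule CkOn_SucI)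
    fix z assume "z \<in> U"
    have "has_partials (\<lambda>_. 1) 0 0 z" by (auto simp: case_prod_unfold)
    from has_partials_divide[OF this f(1) Suc.prems(2)] \<open>z \<in> U\<close>
    show "has_partials (\<lambda>z. 1 / f z)
        (- 1 * f1 z * (1 / f z * (1 / f z))) (- 1 * f2 z * (1 / f z * (1 / f z))) z" by simp
  next
    show "CkOn k U (\<lambda>z. - 1 * f1 z * (1 / f z * (1 / f z)))"
      "CkOn k U (\<lambda>z. - 1 * f2 z * (1 / f z * (1 / f z)))"
      by (intro CkOn_mult CkOn_polyfun2 polyfun2_const f(2,3) inv)+
  qed
qed

lemma Ck_local: "(\<And>z. \<exists>U. open U \<and> z \<in> U \<and> CkOn k U f) \<Longrightarrow> Ck k f"
proof (induction k arbitrary: f)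
  case 0
  have "isCont f z" for z using 0[of z] by (auto simp: continuous_on_eq_continuous_at)
  then show ?case by (simp add: continuous_at_imp_continuous_on)
next
  case (Suc k)
  have "\<exists>U f1 f2. open U \<and> z \<in> U \<and> (\<forall>w\<in>U. has_partials f (f1 w) (f2 w) w) \<and> CkOn k U f1 \<and>
      CkOn k U f2" for z
    using Suc.prems[of z] by auto
  then obtain U f1 f2 where U: "\<And>z. open (U z)" "\<And>z. z \<in> U z"
    and der: "\<And>z w. w \<in> U z \<Longrightarrow> has_partials f (f1 z w) (f2 z w) w"
    and C: "\<And>z. CkOn k (U z) (f1 z)" "\<And>z. CkOn k (U z) (f2 z)" by metis
  have eq: "f1 z w = f1 w w" "f2 z w = f2 w w" if "w \<in> U z" for z w
    using has_partials_unique[OF der[OF that] der[OF U(2)]] by auto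
  have "CkOn k (U z) (\<lambda>w. f1 w w)" "CkOn k (U z) (\<lambda>w. f2 w w)" for z
    by (rule CkOn_cong[OF C(1) U(1) eq(1)] CkOn_cong[OF C(2) U(1) eq(2)]; assumption)+
  then have "Ck k (\<lambda>w. f1 w w)" "Ck k (\<lambda>w. f2 w w)" using U by (intro Suc.IH; blast)+
  then show ?case using der[OF U(2)] unfolding Ck.simps
    by (intro exI[of _ "\<lambda>w. f1 w w"] exI[of _ "\<lambda>w. f2 w w"]) blast
qed

lemma isCont_of_vanishing_at:
  fixes f :: "'a::metric_space \<Rightarrow> real"
  assumes "f z = 0" "f \<in> vanishing_at z 1" shows "isCont f z"
proof -
  have "f \<in> o[at z](\<lambda>w. dist w z ^ 0)"
    by (rule landau_o.big_small_trans[OF assms(2) dist_power_smallo]) simp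
  then have "f \<midarrow>z\<rightarrow> 0" using smalloD_tendsto[of f "at z" "\<lambda>_. 1"] by simp
  with assms(1) show ?thesis by (simp add: isCont_def)
qed

lemma has_derivative_0_of_vanishing_at:
  fixes f :: "'a::real_normed_vector \<Rightarrow> real"
  assumes "f z = 0" "f \<in> vanishing_at z 2" shows "(f has_derivative (\<lambda>_. 0)) (at z)"
proof -
  have "f \<in> o[at z](\<lambda>w. dist w z ^ 1)"
    by (rule landau_o.big_small_trans[OF assms(2) dist_power_smallo]) simp
  then have "((\<lambda>w. f w / dist w z) \<longlongrightarrow> 0) (at z)" by (intro smalloD_tendsto) simp
  then have "((\<lambda>w. norm (f w / dist w z)) \<longlongrightarrow> 0) (at z)" by (rule tendsto_norm_zero)
  then show ?thesis using assms(1) by (simp add: has_derivative_iff_norm dist_norm)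
qed

lemma quotient_vanishing_at:
  assumes P: "P \<in> vanishing_at z (m + n)" and Q: "Q \<in> definite_order_at z m"
  shows "(\<lambda>w. P w / Q w) \<in> vanishing_at z n"
proof -
  have dist_nonzero: "\<forall>\<^sub>F w in at z. dist w z ^ m \<noteq> 0" using eventually_dist_nonzero_at
    by eventually_elim simp
  have "(\<lambda>w. P w / Q w) \<in> O[at z](\<lambda>w. dist w z ^ (m + n) / dist w z ^ m)"
  proof (rule landau_o.big.divide)
    show "\<forall>\<^sub>F w in at z. Q w \<noteq> 0" using dist_nonzero eventually_nonzero_bigtheta[OF Q] by blast
    show "(\<lambda>w. dist w z ^ m) \<in> O[at z](Q)" using Q by (subst (asm) bigtheta_sym) blast
  qed (fact dist_nonzero P)+
  also have "\<forall>\<^sub>F w in at z. dist w z ^ (m + n) / dist w z ^ m = dist w z ^ n"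
    using dist_nonzero by eventually_elim (simp add: power_add)
  then have "(\<lambda>w. dist w z ^ (m + n) / dist w z ^ m) \<in> definite_order_at z n"
    by (rule bigthetaI_cong)
  finally show ?thesis .
qed

lemma vanishing_at_imp_eq_0:
  assumes "polyfun2 f" "f \<in> vanishing_at z (Suc m)" shows "f z = 0"
  using assms(2) taylor_form_0[OF assms(1), of z "(1, 0)"]
  unfolding vanishing_at_iff_taylor_form[OF assms(1)] by auto

lemma vanishing_at_partials_pred:
  assumes f: "polyfun2 f" "polyfun2 f1" "polyfun2 f2" and der: "\<And>w. has_partials f (f1 w) (f2 w) w"
    and "f \<in> vanishing_at z m"
  shows "f1 \<in> vanishing_at z (m - 1)" "f2 \<in> vanishing_at z (m - 1)"
proof (atomize(full), cases m)
  case 0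
  then show "f1 \<in> vanishing_at z (m - 1) \<and> f2 \<in> vanishing_at z (m - 1)"
    using f by (simp add: isCont_bigo_1 isCont_polyfun2)
next
  case (Suc n)
  with assms(5) have "f \<in> vanishing_at z (Suc n)" by simp
  from vanishing_at_partials[OF f der this] Suc
  show "f1 \<in> vanishing_at z (m - 1) \<and> f2 \<in> vanishing_at z (m - 1)" by simp
qed

lemma quotient_numerator_vanishing_at:
  assumes P: "P \<in> vanishing_at z (m + Suc n)" and Q: "Q \<in> vanishing_at z m"
    and P': "P' \<in> vanishing_at z (m + n)" and Q': "Q' \<in> vanishing_at z (m - 1)"
  shows "(\<lambda>w. P' w * Q w - P w * Q' w :: real) \<in> vanishing_at z ((m + m) + n)"
proof (rule sum_in_bigo(2))
  show "(\<lambda>w. P' w * Q w) \<in> vanishing_at z ((m + m) + n)"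
    using landau_o.big.mult[OF P' Q] by (simp add: power_add mult_ac)
  have "(\<lambda>w. P w * Q' w) \<in> vanishing_at z (m + Suc n + (m - 1))"
    using landau_o.big.mult[OF P Q'] by (simp only: power_add)
  also have "(\<lambda>w. dist w z ^ (m + Suc n + (m - 1))) \<in> vanishing_at z ((m + m) + n)"
    by (rule vanishing_at_dist_power) simp
  finally show "(\<lambda>w. P w * Q' w) \<in> vanishing_at z ((m + m) + n)" .
qed

lemma has_partials_0_quotient:
  assumes "P z = 0" "Q \<in> definite_order_at z m" "P \<in> vanishing_at z (m + (2 + n))"
  shows "has_partials (\<lambda>w. P w / Q w) 0 0 z"
proof -
  have "(\<lambda>w. P w / Q w) \<in> vanishing_at z (2 + n)" by (rule quotient_vanishing_at[OF assms(3,2)])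
  then have "(\<lambda>w. P w / Q w) \<in> vanishing_at z 2"
    by (rule landau_o.big_trans[OF _ vanishing_at_dist_power]) simp
  with assms(1) show ?thesis using has_derivative_0_of_vanishing_at[of "\<lambda>w. P w / Q w"]
    by (simp add: case_prod_unfold)
qed

lemma continuous_on_quotient:
  assumes "polyfun2 P" "polyfun2 Q" "\<And>w. w \<in> U \<Longrightarrow> w \<noteq> z \<Longrightarrow> Q w \<noteq> 0"
    and "P z = 0" "Q \<in> definite_order_at z m" "P \<in> vanishing_at z (m + 1)"
  shows "continuous_on U (\<lambda>w. P w / Q w)"
proof (rule continuous_at_imp_continuous_on, rule ballI)
  show "isCont (\<lambda>w. P w / Q w) w" if "w \<in> U" for w
  proof (cases "w = z")
    case True
    have "(\<lambda>w. P w / Q w) \<in> vanishing_at z 1" by (rule quotient_vanishing_at[OF assms(6,5)])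
    then show ?thesis unfolding True using assms(4) by (intro isCont_of_vanishing_at) simp_all
  next
    case False
    then show ?thesis using assms(1-3) that by (intro continuous_divide isCont_polyfun2) auto
  qed
qed

text \<open>The value at \<open>z\<close> is 0 in any case: if \<open>Q z = 0\<close>, then \<open>P z / Q z = 0\<close> by convention.\<close>
lemma quotient_partials:
  assumes PQ: "polyfun2 P" "polyfun2 Q"
    and Q: "Q \<in> definite_order_at z m" and P: "P \<in> vanishing_at z (m + Suc (Suc k))"
  obtains N1 N2 where "polyfun2 N1" "polyfun2 N2"
    "N1 \<in> vanishing_at z ((m + m) + Suc k)" "N2 \<in> vanishing_at z ((m + m) + Suc k)"
    "\<And>w. Q w \<noteq> 0 \<or> w = z \<Longrightarrow> has_partials (\<lambda>w. P w / Q w) (N1 w / (Q w * Q w)) (N2 w / (Q w * Q w)) w"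
proof -
  obtain P1 P2 where P': "polyfun2 P1" "polyfun2 P2" "\<And>w. has_partials P (P1 w) (P2 w) w"
    by (rule polyfun2_has_partials[OF PQ(1)]) (rule that)
  obtain Q1 Q2 where Q': "polyfun2 Q1" "polyfun2 Q2" "\<And>w. has_partials Q (Q1 w) (Q2 w) w"
    by (rule polyfun2_has_partials[OF PQ(2)]) (rule that)
  note P_vanishing = P[unfolded add_Suc_right] and Q_vanishing = bigthetaD1[OF Q]
  note P_partials = vanishing_at_partials[OF PQ(1) P' P_vanishing]
  note Q_partials = vanishing_at_partials_pred[OF PQ(2) Q' Q_vanishing]
  define N1 where "N1 = (\<lambda>w. P1 w * Q w - P w * Q1 w)"
  define N2 where "N2 = (\<lambda>w. P2 w * Q w - P w * Q2 w)"
  have N: "N1 \<in> vanishing_at z ((m + m) + Suc k)" "N2 \<in> vanishing_at z ((m + m) + Suc k)"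
    unfolding N1_def N2_def
    by (intro quotient_numerator_vanishing_at[OF P Q_vanishing _ Q_partials(1)]
        quotient_numerator_vanishing_at[OF P Q_vanishing _ Q_partials(2)];
        use P_partials in simp)+
  have poly: "polyfun2 N1" "polyfun2 N2"
    unfolding N1_def N2_def by (intro polyfun2_diff polyfun2_mult P' Q' PQ)+
  show ?thesis
  proof (rule that[OF poly N])
    show "has_partials (\<lambda>w. P w / Q w) (N1 w / (Q w * Q w)) (N2 w / (Q w * Q w)) w"
      if "Q w \<noteq> 0 \<or> w = z" for w
    proof (cases "w = z")
      case True
      have "P z = 0" "N1 z = 0" "N2 z = 0"
        using vanishing_at_imp_eq_0[OF PQ(1) P_vanishing] vanishing_at_imp_eq_0[OF poly(1)]
          vanishing_at_imp_eq_0[OF poly(2)] N unfolding add_Suc_right by blast+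
      then show ?thesis using has_partials_0_quotient[of P z Q m k] Q P True by simp
    next
      case False
      then show ?thesis unfolding N1_def N2_def
        by (intro has_partials_divide P' Q') (use that in blast)
    qed
  qed
qed

lemma CkOn_quotient:
  assumes "polyfun2 P" "polyfun2 Q" "\<And>w. w \<in> U \<Longrightarrow> w \<noteq> z \<Longrightarrow> Q w \<noteq> 0"
    "Q \<in> definite_order_at z m" "P \<in> vanishing_at z (m + Suc k)"
  shows "CkOn k U (\<lambda>w. P w / Q w)"
  using assms
proof (induction k arbitrary: P Q m)
  case 0
  have "P z = 0" using vanishing_at_imp_eq_0[OF "0.prems"(1)] "0.prems"(5) by simp
  with continuous_on_quotient[OF "0.prems"(1-3)] "0.prems"(4,5) show ?case by simp
next
  case (Suc k)
  obtain N1 N2 where poly: "polyfun2 N1" "polyfun2 N2"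
    and N: "N1 \<in> vanishing_at z ((m + m) + Suc k)" "N2 \<in> vanishing_at z ((m + m) + Suc k)"
    and partials: "\<And>w. Q w \<noteq> 0 \<or> w = z \<Longrightarrow>
      has_partials (\<lambda>w. P w / Q w) (N1 w / (Q w * Q w)) (N2 w / (Q w * Q w)) w"
    by (rule quotient_partials[OF Suc.prems(1,2,4,5)]) (rule that)
  have square_poly: "polyfun2 (\<lambda>w. Q w * Q w)" by (intro polyfun2_mult Suc.prems(2))
  have square_order: "(\<lambda>w. Q w * Q w) \<in> definite_order_at z (m + m)"
    unfolding power_add by (intro landau_theta.mult Suc.prems(4))
  have square_nonzero: "Q w * Q w \<noteq> 0" if "w \<in> U" "w \<noteq> z" for w using Suc.prems(3)[OF that] by simp
  show ?case
  proof (rule CkOn_SucI)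
    show "has_partials (\<lambda>w. P w / Q w) (N1 w / (Q w * Q w)) (N2 w / (Q w * Q w)) w" if "w \<in> U" for w
      using Suc.prems(3)[OF that] by (intro partials) blast
    show "CkOn k U (\<lambda>w. N1 w / (Q w * Q w))"
      by (rule Suc.IH[OF poly(1) square_poly _ square_order N(1)]) (rule square_nonzero)
    show "CkOn k U (\<lambda>w. N2 w / (Q w * Q w))"
      by (rule Suc.IH[OF poly(2) square_poly _ square_order N(2)]) (rule square_nonzero)
  qed
qed

section \<open>Fractions with definite denominators\<close>

definition blowup_chart :: "pt \<Rightarrow> pt \<Rightarrow> pt" where
  "blowup_chart a w = (fst a + fst w, snd a + fst w * snd w)"

lemma blowup_chart_eq: "blowup_chart a w = a + fst w *\<^sub>R (1, snd w)"
  by (simp add: blowup_chart_def prod_eq_iff)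

lemma polyfun2_blowup_chart: "polyfun2 f \<Longrightarrow> polyfun2 (\<lambda>w. f (blowup_chart a w))"
  unfolding blowup_chart_def by (erule polyfun2_compose; intro polyfun2_intros)

lemma continuous_on_blowup_chart:
  fixes \<phi> :: "pt \<Rightarrow> real"
  assumes "continuous_on UNIV \<phi>" shows "continuous_on UNIV (\<lambda>w. \<phi> (blowup_chart a w))"
  unfolding blowup_chart_def
  by (rule continuous_on_compose2[OF assms]) (auto intro!: continuous_intros)

lemma continuous_on_swap:
  fixes \<phi> :: "pt \<Rightarrow> real"
  assumes "continuous_on UNIV \<phi>" shows "continuous_on UNIV (\<lambda>w. \<phi> (prod.swap w))"
  unfolding prod.swap_def
  by (rule continuous_on_compose2[OF assms]) (auto intro!: continuous_intros)

lemma regular_on_swap: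
  assumes "regular_on S F" shows "regular_on (prod.swap -` S) (\<lambda>w. F (prod.swap w))"
  unfolding regular_on_def
proof
  fix x assume "x \<in> prod.swap -` S"
  then obtain p q
    where pq: "polyfun2 p" "polyfun2 q" "q (prod.swap x) \<noteq> 0" "\<forall>y\<in>S. q y \<noteq> 0 \<longrightarrow> F y = p y / q y"
    using assms unfolding regular_on_def by blast
  show "\<exists>p q. polyfun2 p \<and> polyfun2 q \<and> q x \<noteq> 0 \<and>
      (\<forall>y\<in>prod.swap -` S. q y \<noteq> 0 \<longrightarrow> F (prod.swap y) = p y / q y)"
    by (intro exI[of _ "\<lambda>z. p (prod.swap z)"] exI[of _ "\<lambda>z. q (prod.swap z)"] conjI polyfun2_swap
        pq) (use pq(4) in auto)
qed

lemma regular_on_swap_iff: "regular_on (prod.swap -` S) (\<lambda>w. F (prod.swap w)) \<longleftrightarrow> regular_on S F"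
  using regular_on_swap[of S F] regular_on_swap[of "prod.swap -` S" "\<lambda>w. F (prod.swap w)"]
  by (auto simp: vimage_def)

definition regular_on_chart :: "pt set \<Rightarrow> (pt \<Rightarrow> real) \<Rightarrow> pt \<Rightarrow> bool" where
  "regular_on_chart A f a \<longleftrightarrow> regular_on {w. blowup_chart a w \<notin> A - {a}} (\<lambda>w. f (blowup_chart a w))"

lemma regular_after_blowup_iff:
  "regular_after_blowup A f \<longleftrightarrow> regular_on (- A) f \<and>
    (\<forall>a\<in>A. regular_on_chart A f a \<and>
      regular_on_chart (prod.swap -` A) (\<lambda>w. f (prod.swap w)) (prod.swap a))"
proof -
  have "regular_on {(u, v). (fst a + u, snd a + u * v) \<notin> A - {a}}
        (\<lambda>(u, v). f (fst a + u, snd a + u * v)) \<longleftrightarrow> regular_on_chart A f a" for a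
    by (simp add: regular_on_chart_def blowup_chart_def case_prod_unfold)
  moreover have "regular_on {(u, v). (fst a + u * v, snd a + v) \<notin> A - {a}}
        (\<lambda>(u, v). f (fst a + u * v, snd a + v)) \<longleftrightarrow>
      regular_on_chart (prod.swap -` A) (\<lambda>w. f (prod.swap w)) (prod.swap a)" for a
  proof -
    have "prod.swap -` {(u, v). (fst a + u * v, snd a + v) \<notin> A - {a}} =
        {w. blowup_chart (prod.swap a) w \<notin> prod.swap -` A - {prod.swap a}}"
      by (auto simp: blowup_chart_def prod_eq_iff mult.commute)
    moreover have "(\<lambda>w. case prod.swap w of (u, v) \<Rightarrow> f (fst a + u * v, snd a + v)) =
        (\<lambda>w. f (prod.swap (blowup_chart (prod.swap a) w)))"
      by (auto simp: blowup_chart_def case_prod_unfold mult.commute)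
    ultimately show ?thesis
      using regular_on_swap_iff[of "{(u, v). (fst a + u * v, snd a + v) \<notin> A - {a}}"
        "\<lambda>(u, v). f (fst a + u * v, snd a + v)"]
      by (simp only: regular_on_chart_def)
  qed
  ultimately show ?thesis unfolding regular_after_blowup_def by presburger
qed

lemma strict_transform:
  assumes f: "polyfun2 f" and "f \<in> vanishing_at a m"
  obtains f' where "polyfun2 f'" "\<And>w. f (blowup_chart a w) = fst w ^ m * f' w"
    "\<And>v. f' (0, v) = taylor_form f a m (1, v)"
proof -
  obtain n where n: "\<And>z h m. m \<ge> n \<Longrightarrow> f (z + h) = (\<Sum>s\<le>m. taylor_form f z s h)"
    by (rule taylor_expansion[OF f]) (rule that)
  define f' where "f' = (\<lambda>w. \<Sum>s=m..n+m. fst w ^ (s - m) * taylor_form f a s (1, snd w))"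
  have lower_forms: "taylor_form f a s = (\<lambda>_. 0)" if "s < m" for s
    using assms(2) that by (simp add: vanishing_at_iff_taylor_form f)
  show ?thesis
  proof (rule that)
    show "polyfun2 f'" unfolding f'_def
      by (intro polyfun2_sum polyfun2_mult polyfun2_power polyfun2_fst
          polyfun2_compose[OF polyfun2_taylor_form[OF f] polyfun2_const polyfun2_snd])
    show "f (blowup_chart a w) = fst w ^ m * f' w" for w
    proof -
      have "f (blowup_chart a w) = (\<Sum>s\<le>n+m. fst w ^ s * taylor_form f a s (1, snd w))"
        unfolding blowup_chart_eq
        by (subst n[of "n + m"]) (simp_all add: taylor_form_scaleR[OF f] del: scaleR_Pair)
      also have "\<dots> = (\<Sum>s=m..n+m. fst w ^ s * taylor_form f a s (1, snd w))"
        by (rule sum.mono_neutral_right) (auto simp: lower_forms)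
      also have "\<dots> = fst w ^ m * f' w"
        unfolding f'_def sum_distrib_left by (rule sum.cong) (auto simp flip: mult.assoc power_add)
      finally show ?thesis .
    qed
    have "f' (0, v) = (\<Sum>s\<in>{m}. 0 ^ (s - m) * taylor_form f a s (1, v))" for v
      unfolding f'_def fst_conv snd_conv by (rule sum.mono_neutral_right) auto
    then show "f' (0, v) = taylor_form f a m (1, v)" for v by simp
  qed
qed

lemma definite_strict_transform_nonzero:
  assumes Q: "polyfun2 Q" "Q \<in> definite_order_at a m"
    and Q': "\<And>w. Q (blowup_chart a w) = fst w ^ m * Q' w" "\<And>v. Q' (0, v) = taylor_form Q a m (1, v)"
    and w: "blowup_chart a w \<notin> {z. Q z = 0} - {a}"
  shows "Q' w \<noteq> 0"
proof (cases "fst w = 0")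
  case True
  have "taylor_form Q a m (1, snd w) \<noteq> 0"
    by (rule definite_order_at_imp_taylor_form_nonzero[OF Q]) (simp add: zero_prod_def)
  with True Q'(2)[of "snd w"] show ?thesis by (metis prod.collapse)
next
  case False
  then have "blowup_chart a w \<noteq> a" by (auto simp: blowup_chart_def prod_eq_iff)
  then show ?thesis using w Q'(1)[of w] by auto
qed

lemma regular_on_chart_of_definite_fraction:
  assumes cont: "continuous_on UNIV \<phi>" and P: "polyfun2 P" and Q: "definite_poly Q"
    and eq: "\<And>z. \<phi> z * Q z = P z"
  shows "regular_on_chart {z. Q z = 0} \<phi> a"
proof -
  have Q_poly: "polyfun2 Q" by (rule definite_polyD(1)[OF Q])
  obtain m where m: "Q \<in> definite_order_at a m" by (rule definite_atE[OF definite_polyD(2)[OF Q]])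
  have "isCont \<phi> a" using cont continuous_on_eq_continuous_at by blast
  then have "(\<lambda>z. \<phi> z * Q z) \<in> O[at a](\<lambda>w. 1 * dist w a ^ m)"
    using m by (intro landau_o.big.mult isCont_bigo_1) auto
  then have "P \<in> vanishing_at a m" using eq by simp
  then obtain P' where P': "polyfun2 P'" "\<And>w. P (blowup_chart a w) = fst w ^ m * P' w"
    by (rule strict_transform[OF P]) (rule that)
  obtain Q' where Q': "polyfun2 Q'" "\<And>w. Q (blowup_chart a w) = fst w ^ m * Q' w"
    "\<And>v. Q' (0, v) = taylor_form Q a m (1, v)"
    using m by (rule strict_transform[OF Q_poly bigthetaD1]) (rule that)
  have "\<phi> (blowup_chart a w) * Q' w = P' w" for w
  proof (rule continuous_eq_off_zeros[OF polyfun2_fst _ finite.emptyI])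
    show "fst \<noteq> (\<lambda>w::pt. 0)" by (metis fst_conv zero_neq_one)
    show "continuous_on UNIV (\<lambda>w. \<phi> (blowup_chart a w) * Q' w)" "continuous_on UNIV P'"
      by (intro continuous_on_mult continuous_on_blowup_chart cont continuous_on_polyfun2 P' Q')+
    show "\<phi> (blowup_chart a w) * Q' w = P' w" if "fst w \<noteq> 0" for w
      using eq[of "blowup_chart a w"] that by (simp add: P'(2) Q'(2))
  qed
  then have "\<phi> (blowup_chart a w) = P' w / Q' w" if "Q' w \<noteq> 0" for w
    using that by (simp add: field_simps)
  then show ?thesis unfolding regular_on_chart_def regular_on_def
    using P'(1) Q'(1) definite_strict_transform_nonzero[OF Q_poly m Q'(2,3)] by blast
qed

lemma taylor_form_swap:
  assumes "polyfun2 f"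
  shows "taylor_form (\<lambda>w. f (prod.swap w)) (prod.swap z) s (prod.swap h) = taylor_form f z s h"
proof -
  have "line_poly (\<lambda>w. f (prod.swap w)) (prod.swap z) (prod.swap h) = line_poly f z h"
    by (rule line_poly_eqI)
      (simp add: poly_line_poly[OF assms] prod.swap_def prod_eq_iff plus_prod_def)
  then show ?thesis by (simp add: taylor_form_def)
qed

lemma definite_poly_swap:
  assumes Q: "definite_poly Q" shows "definite_poly (\<lambda>w. Q (prod.swap w))"
  unfolding definite_poly_def
proof (intro conjI allI)
  have Qp: "polyfun2 Q" by (rule definite_polyD(1)[OF Q])
  show Qs: "polyfun2 (\<lambda>w. Q (prod.swap w))" by (rule polyfun2_swap[OF Qp])
  fix z :: pt
  obtain m where m: "Q \<in> definite_order_at (prod.swap z) m"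
    by (rule definite_atE[OF definite_polyD(2)[OF Q]])
  have "taylor_form (\<lambda>w. Q (prod.swap w)) z s h = taylor_form Q (prod.swap z) s (prod.swap h)"
    for s h
    using taylor_form_swap[OF Qp, of "prod.swap z" s "prod.swap h"] by simp
  moreover have "prod.swap h \<noteq> 0" if "h \<noteq> 0" for h :: pt using that by (auto simp: prod_eq_iff)
  moreover have "Q \<in> vanishing_at (prod.swap z) m" using m by blast
  ultimately have "(\<lambda>w. Q (prod.swap w)) \<in> definite_order_at z m"
    using definite_order_at_imp_taylor_form_nonzero[OF Qp m]
    by (intro definite_order_atI[OF Qs])
      (simp_all add: vanishing_at_iff_taylor_form Qp Qs fun_eq_iff)
  then show "definite_at z (\<lambda>w. Q (prod.swap w))" by (rule definite_atI)
qed

lemma Ck_imp_continuous_on: "Ck k f \<Longrightarrow> continuous_on UNIV f"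
  using CkOn_imp_continuous_on[of k UNIV f] by (simp add: CkOn_UNIV)

lemma Rk1I:
  assumes Ck: "Ck k \<phi>" and P: "polyfun2 P" and Q: "definite_poly Q" and eq: "\<And>z. \<phi> z * Q z = P z"
  shows "\<phi> \<in> Rk1 k"
proof -
  have cont: "continuous_on UNIV \<phi>" by (rule Ck_imp_continuous_on[OF Ck])
  have Qp: "polyfun2 Q" by (rule definite_polyD(1)[OF Q])
  have div: "\<phi> z = P z / Q z" if "Q z \<noteq> 0" for z using eq[of z] that by (simp add: field_simps)
  have "zariski_open {z. Q z \<noteq> 0}" unfolding zariski_open_def zariski_closed_def
    by (rule exI[of _ "{Q}"]) (use Qp in auto)
  moreover have "{z. Q z \<noteq> 0} \<noteq> {}" using definite_poly_neq_0[OF Q] by auto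
  ultimately have "\<phi> \<in> Rk k" unfolding Rk_def using Ck P Qp div
    by (intro CollectI conjI exI[of _ P] exI[of _ Q] exI[of _ "{z. Q z \<noteq> 0}"]) auto
  moreover have "regular_after_blowup {z. Q z = 0} \<phi>"
    unfolding regular_after_blowup_iff
  proof (intro conjI ballI)
    show "regular_on (- {z. Q z = 0}) \<phi>" unfolding regular_on_def
      by (intro ballI exI[of _ P] exI[of _ Q]) (use P Qp div in auto)
    show "regular_on_chart {z. Q z = 0} \<phi> a" for a
      by (rule regular_on_chart_of_definite_fraction[OF cont P Q eq])
    show "regular_on_chart (prod.swap -` {z. Q z = 0}) (\<lambda>w. \<phi> (prod.swap w)) (prod.swap a)" for a
      unfolding vimage_Collect_eq
      by (rule regular_on_chart_of_definite_fraction[OF continuous_on_swap[OF cont]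
          polyfun2_swap[OF P] definite_poly_swap[OF Q] eq])
  qed
  ultimately show ?thesis unfolding Rk1_def using finite_zeros_definite_poly[OF Q] by blast
qed

lemma Rk_imp_fraction:
  assumes "\<phi> \<in> Rk k"
  obtains f g where "polyfun2 f" "polyfun2 g" "g \<noteq> (\<lambda>_. 0)" "\<And>z. \<phi> z * g z = f z"
proof -
  have cont: "continuous_on UNIV \<phi>" using assms Ck_imp_continuous_on unfolding Rk_def by blast
  obtain f g U
    where U: "polyfun2 f" "polyfun2 g" "zariski_open U" "U \<noteq> {}" "\<forall>z\<in>U. g z \<noteq> 0 \<and> \<phi> z = f z / g z"
    using assms unfolding Rk_def by blast
  obtain S where S: "\<forall>s\<in>S. polyfun2 s" "- U = {z. \<forall>s\<in>S. s z = 0}"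
    using U(3) unfolding zariski_open_def zariski_closed_def by blast
  obtain z0 where z0: "z0 \<in> U" using U(4) by blast
  then obtain s where s: "s \<in> S" "s z0 \<noteq> 0" using S(2) by blast
  have "\<phi> z * g z = f z" for z
  proof (rule continuous_eq_off_zeros[of s "{}"])
    show "polyfun2 s" "s \<noteq> (\<lambda>_. 0)" using s S(1) by auto
    show "continuous_on UNIV (\<lambda>z. \<phi> z * g z)" "continuous_on UNIV f"
      by (intro continuous_on_mult cont continuous_on_polyfun2 U)+
    fix z assume "s z \<noteq> 0"
    then have "z \<in> U" using s(1) S(2) by blast
    then show "\<phi> z * g z = f z" using U(5) by simp
  qed simp
  moreover have "g \<noteq> (\<lambda>_. 0)" using U(5) z0 by auto
  ultimately show ?thesis using that U(1,2) by blast
qed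

lemma Rk_imp_coprime_fraction:
  assumes "\<phi> \<in> Rk k"
  obtains p q where "q \<noteq> 0" "coprime p q" "\<And>z. \<phi> z * poly2 q z = poly2 p z"
proof -
  have cont: "continuous_on UNIV \<phi>" using assms Ck_imp_continuous_on unfolding Rk_def by blast
  obtain f g where fg: "polyfun2 f" "polyfun2 g" "g \<noteq> (\<lambda>_. 0)" "\<And>z. \<phi> z * g z = f z"
    by (rule Rk_imp_fraction[OF assms]) (rule that)
  obtain p where p: "f = poly2 p" using fg(1) by (rule polyfun2E)
  obtain q where q: "g = poly2 q" using fg(2) by (rule polyfun2E)
  have "q \<noteq> 0" using fg(3) poly2_eq_0_iff[of q] by (simp add: q)
  then have gcd: "gcd p q \<noteq> 0" by simp
  then obtain P Q where PQ: "p = P * gcd p q" "q = Q * gcd p q" "coprime P Q"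
    using gcd_coprime_exists[OF gcd] by blast
  have "\<phi> z * poly2 Q z = poly2 P z" for z
  proof (rule continuous_eq_off_zeros[of "poly2 (gcd p q)" "{}"])
    show "poly2 (gcd p q) \<noteq> (\<lambda>_. 0)" using gcd poly2_eq_0_iff by blast
    show "continuous_on UNIV (\<lambda>z. \<phi> z * poly2 Q z)" "continuous_on UNIV (poly2 P)"
      by (intro continuous_on_mult cont continuous_on_polyfun2 polyfun2_poly2)+
    fix w :: pt assume "poly2 (gcd p q) w \<noteq> 0"
    moreover have "\<phi> w * poly2 (Q * gcd p q) w = poly2 (P * gcd p q) w"
      using fg(4)[of w] unfolding p q PQ(1,2)[symmetric] .
    ultimately show "\<phi> w * poly2 Q w = poly2 P w" by simp
  qed (simp_all add: polyfun2_poly2)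
  moreover have "Q \<noteq> 0" using \<open>q \<noteq> 0\<close> PQ(2) by auto
  ultimately show ?thesis using that PQ(3) by blast
qed

lemma regular_on_imp_global_fraction:
  assumes cont: "continuous_on UNIV F" and "regular_on S F" and "finite (- S)" and "x \<in> S"
  obtains r s where "poly2 s x \<noteq> 0" "\<And>z. F z * poly2 s z = poly2 r z"
proof -
  obtain f g where fg: "polyfun2 f" "polyfun2 g" "g x \<noteq> 0" "\<forall>y\<in>S. g y \<noteq> 0 \<longrightarrow> F y = f y / g y"
    using assms(2) \<open>x \<in> S\<close> unfolding regular_on_def by blast
  have "F z * g z = f z" for z
  proof (rule continuous_eq_off_zeros[OF fg(2) _ \<open>finite (- S)\<close>])
    show "g \<noteq> (\<lambda>_. 0)" using fg(3) by auto
    show "continuous_on UNIV (\<lambda>z. F z * g z)" "continuous_on UNIV f"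
      by (intro continuous_on_mult cont continuous_on_polyfun2 fg)+
  qed (use fg(4) in simp)
  then show ?thesis using that fg(1-3) by (elim polyfun2E) blast
qed

lemma finite_blowup_chart_vimage:
  assumes "finite B" "a \<notin> B" shows "finite (blowup_chart a -` B)"
proof -
  have "inj_on (blowup_chart a) {w. fst w \<noteq> 0}"
    by (auto simp: inj_on_def blowup_chart_def prod_eq_iff)
  then have "finite (blowup_chart a -` B \<inter> {w. fst w \<noteq> 0})"
    by (rule finite_vimage_IntI[OF assms(1)])
  moreover have "blowup_chart a -` B \<subseteq> blowup_chart a -` B \<inter> {w. fst w \<noteq> 0}"
    using assms(2) by (auto simp: blowup_chart_def)
  ultimately show ?thesis by (rule finite_subset[rotated])
qed

lemma coprime_denominator_dvd:
  fixes \<phi> :: "pt \<Rightarrow> real"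
  assumes "coprime p q" "\<And>z. \<phi> z * poly2 q z = poly2 p z" "\<And>z. \<phi> z * poly2 s z = poly2 r z"
  shows "q dvd s"
proof -
  have "poly2 p z * poly2 s z = poly2 q z * poly2 r z" for z
    using assms(2)[of z] assms(3)[of z] by (metis mult.assoc mult.commute)
  then have "poly2 (p * s) = poly2 (q * r)" by (auto simp: fun_eq_iff)
  then have "p * s = q * r" by (simp only: poly2_inject)
  then have "q dvd p * s" by (rule dvdI)
  then show ?thesis using assms(1) by (simp add: coprime_dvd_mult_right_iff coprime_commute)
qed

lemma prime_elem_linear_monic: "prime_elem [:- a, 1 :: 'a::idom:]"
  by (rule prime_elemI) (auto simp: dvd_iff_poly_eq_0)

lemma taylor_form_eq_0I:
  assumes f: "polyfun2 f" and zero: "\<And>v. taylor_form f a m (1, v) = 0"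
  shows "taylor_form f a m = (\<lambda>_. 0)"
proof -
  have "fst h * taylor_form f a m h = 0" for h
    using taylor_form_scaleR[OF f, of a m "fst h" "(1, snd h / fst h)"] zero
    by (cases "fst h = 0") simp_all
  then have "fst = (\<lambda>_::pt. 0) \<or> taylor_form f a m = (\<lambda>_. 0)"
    by (intro polyfun2_mult_eq_0 polyfun2_fst polyfun2_taylor_form f)
  then show ?thesis by (metis fst_conv zero_neq_one)
qed

lemma strict_transform_coprime_exceptional:
  assumes "taylor_form (poly2 q) a m \<noteq> (\<lambda>_. 0)"
    "\<And>v. poly2 q' (0, v) = taylor_form (poly2 q) a m (1, v)"
  shows "coprime q' ([:0, 1:] ^ n)"
proof -
  have "\<not> [:0, 1:] dvd q'"
  proof
    assume "[:0, 1:] dvd q'"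
    then have "taylor_form (poly2 q) a m (1, v) = 0" for v by (elim dvdE) (simp flip: assms(2))
    then show False using taylor_form_eq_0I[OF polyfun2_poly2] assms(1) by blast
  qed
  then have "coprime [:0, 1:] q'"
    using prime_elem_imp_coprime prime_elem_linear_monic[of "0 :: real poly"] by simp
  then show ?thesis by (simp add: coprime_commute)
qed

lemma chart_denominator_identity:
  assumes "coprime p q" and eq: "\<And>z. \<phi> z * poly2 q z = poly2 p z"
    and q': "\<And>w. poly2 q (blowup_chart a w) = fst w ^ N * poly2 q' w"
    and s: "\<And>w. \<phi> (blowup_chart a w) * poly2 s w = poly2 r w"
  obtains n E T where "[:0, 1:] ^ n * (E * s) = [:0, 1:] ^ N * (q' * T)" "\<And>v. poly2 E (0, v) \<noteq> 0"
proof -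
  obtain c where c: "c \<noteq> 0" "swap_vars [:c:] \<in> ideal_span {p, q}"
    by (rule coprime_bezout_univariate[OF assms(1)])
  then obtain \<alpha> \<beta> where bezout: "swap_vars [:c:] = \<alpha> * p + \<beta> * q" unfolding ideal_span_pair by blast
  define n where "n = order (fst a) c"
  obtain e where e: "c = [:- fst a, 1:] ^ n * e" "poly e (fst a) \<noteq> 0"
    using order_decomp[OF c(1), of "fst a"] by (auto simp: n_def dvd_iff_poly_eq_0)
  obtain E where E: "(\<lambda>w. poly e (fst a + fst w)) = poly2 E"
    by (rule polyfun2E[of "\<lambda>w. poly e (fst a + fst w)"]) (intro polyfun2_intros)
  let ?T = "\<lambda>w. poly2 \<alpha> (blowup_chart a w) * poly2 r w + poly2 \<beta> (blowup_chart a w) * poly2 s w"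
  obtain T where T: "?T = poly2 T"
    by (rule polyfun2E[of ?T]) (intro polyfun2_intros polyfun2_blowup_chart)
  have "poly2 ([:0, 1:] ^ n * (E * s)) w = poly2 ([:0, 1:] ^ N * (q' * T)) w" for w
  proof -
    let ?z = "blowup_chart a w"
    have "poly2 ([:0, 1:] ^ n * (E * s)) w = poly c (fst ?z) * poly2 s w"
      by (simp add: e(1) blowup_chart_def flip: E)
    also have "poly c (fst ?z) = poly2 (swap_vars [:c:]) ?z" by simp
    also have "\<dots> * poly2 s w =
        poly2 q ?z * (poly2 \<alpha> ?z * (\<phi> ?z * poly2 s w) + poly2 \<beta> ?z * poly2 s w)"
      unfolding bezout by (simp add: algebra_simps flip: eq)
    also have "\<dots> = poly2 ([:0, 1:] ^ N * (q' * T)) w" by (simp add: s q' flip: T)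
    finally show ?thesis .
  qed
  then have "[:0, 1:] ^ n * (E * s) = [:0, 1:] ^ N * (q' * T)"
    by (simp only: ext flip: poly2_inject)
  moreover have "poly2 E (0, v) \<noteq> 0" for v using e(2) by (simp flip: E)
  ultimately show ?thesis by (rule that)
qed

text \<open>
  In the chart, the Bezout identity \<open>c(x) = \<alpha> p + \<beta> q\<close> gives \<open>u\<^sup>n E s = u\<^sup>N q' T\<close>, where
  \<open>s\<close> is a denominator of the pulled back fraction, \<open>u\<close> the exceptional coordinate and \<open>q'\<close> the strict
  transform of \<open>q\<close>. As \<open>q'\<close> is coprime to \<open>u\<close>, it divides \<open>E s\<close>.
\<close>
lemma taylor_form_denominator_nonzero:
  assumes cont: "continuous_on UNIV \<phi>" and coprime: "coprime p q"
    and eq: "\<And>z. \<phi> z * poly2 q z = poly2 p z"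
    and "finite A" and reg: "regular_on_chart A \<phi> a"
    and q: "poly2 q \<in> vanishing_at a N" "taylor_form (poly2 q) a N \<noteq> (\<lambda>_. 0)"
  shows "taylor_form (poly2 q) a N (1, v) \<noteq> 0"
proof -
  obtain f where f: "polyfun2 f" "\<And>w. poly2 q (blowup_chart a w) = fst w ^ N * f w"
    "\<And>v. f (0, v) = taylor_form (poly2 q) a N (1, v)"
    by (rule strict_transform[OF polyfun2_poly2 q(1)]) (rule that)
  obtain q' where "f = poly2 q'" using f(1) by (rule polyfun2E)
  then have q': "\<And>w. poly2 q (blowup_chart a w) = fst w ^ N * poly2 q' w"
    "\<And>v. poly2 q' (0, v) = taylor_form (poly2 q) a N (1, v)"
    using f(2,3) by simp_all
  obtain r s where s: "poly2 s (0, v) \<noteq> 0" "\<And>w. \<phi> (blowup_chart a w) * poly2 s w = poly2 r w"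
  proof (rule regular_on_imp_global_fraction[OF continuous_on_blowup_chart[OF cont]
      reg[unfolded regular_on_chart_def]])
    have "- {w. blowup_chart a w \<notin> A - {a}} = blowup_chart a -` (A - {a})" by auto
    then show "finite (- {w. blowup_chart a w \<notin> A - {a}})"
      using finite_blowup_chart_vimage[of "A - {a}" a] \<open>finite A\<close> by simp
    show "(0, v) \<in> {w. blowup_chart a w \<notin> A - {a}}" by (simp add: blowup_chart_def)
  qed (rule that)
  obtain n E T where E: "[:0, 1:] ^ n * (E * s) = [:0, 1:] ^ N * (q' * T)" "\<And>v. poly2 E (0, v) \<noteq> 0"
    by (rule chart_denominator_identity[OF coprime eq q'(1) s(2)]) (rule that)
  have "q' dvd [:0, 1:] ^ n * (E * s)" unfolding E(1) by simp
  moreover have "coprime q' ([:0, 1:] ^ n)"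
    by (rule strict_transform_coprime_exceptional[OF q(2) q'(2)])
  ultimately have "q' dvd E * s" by (simp add: coprime_dvd_mult_right_iff)
  then obtain t where "E * s = q' * t" by (elim dvdE)
  then have "poly2 E (0, v) * poly2 s (0, v) = poly2 q' (0, v) * poly2 t (0, v)"
    by (metis poly2_simps(5))
  then show ?thesis using s(1) E(2) q'(2) by (metis mult_eq_0_iff)
qed

lemma taylor_form_nonzeroI:
  assumes f: "polyfun2 f"
    and axes: "\<And>v. taylor_form f a m (1, v) \<noteq> 0" "taylor_form f a m (0, 1) \<noteq> 0" and "h \<noteq> 0"
  shows "taylor_form f a m h \<noteq> 0"
proof (cases "fst h = 0")
  case True
  then have "h = snd h *\<^sub>R (0, 1)" "snd h \<noteq> 0" using \<open>h \<noteq> 0\<close> by (auto simp: prod_eq_iff)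
  then show ?thesis using axes(2) taylor_form_scaleR[OF f] by (metis mult_eq_0_iff power_not_zero)
next
  case False
  then have "h = fst h *\<^sub>R (1, snd h / fst h)" by (simp add: prod_eq_iff)
  then show ?thesis using axes(1) False taylor_form_scaleR[OF f]
    by (metis mult_eq_0_iff power_not_zero)
qed

lemma definite_at_coprime_denominator:
  assumes cont: "continuous_on UNIV \<phi>"
    and pq: "coprime p q" "\<And>z. \<phi> z * poly2 q z = poly2 p z" "q \<noteq> 0"
    and A: "finite A" "regular_on_chart A \<phi> a"
      "regular_on_chart (prod.swap -` A) (\<lambda>w. \<phi> (prod.swap w)) (prod.swap a)"
  shows "definite_at a (poly2 q)"
proof -
  have "poly2 q \<noteq> (\<lambda>_. 0)" using pq(3) poly2_eq_0_iff by blast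
  then obtain N where N: "poly2 q \<in> vanishing_at a N" "taylor_form (poly2 q) a N \<noteq> (\<lambda>_. 0)"
    by (rule exists_initial_form[OF polyfun2_poly2])
  have form_swap: "taylor_form (poly2 (swap_vars q)) (prod.swap a) s h =
      taylor_form (poly2 q) a s (prod.swap h)" for s h
    using taylor_form_swap[OF polyfun2_poly2, of q a s "prod.swap h"]
    by (simp add: poly2_swap_vars[abs_def])
  have "taylor_form (poly2 (swap_vars q)) (prod.swap a) N (1, 0) \<noteq> 0"
  proof (rule taylor_form_denominator_nonzero[OF continuous_on_swap[OF cont]
      coprime_swap_vars[OF pq(1)] _ _ A(3)])
    show "\<phi> (prod.swap z) * poly2 (swap_vars q) z = poly2 (swap_vars p) z" for z
      by (simp add: pq(2))
    show "finite (prod.swap -` A)" using A(1) by (intro finite_vimageI) simp_all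
    show "poly2 (swap_vars q) \<in> vanishing_at (prod.swap a) N"
      using N(1) by (simp add: vanishing_at_iff_taylor_form polyfun2_poly2 fun_eq_iff form_swap)
    show "taylor_form (poly2 (swap_vars q)) (prod.swap a) N \<noteq> (\<lambda>_. 0)"
      using N(2) form_swap by (metis swap_swap)
  qed
  then have vertical: "taylor_form (poly2 q) a N (0, 1) \<noteq> 0" by (simp add: form_swap)
  have "taylor_form (poly2 q) a N h \<noteq> 0" if "h \<noteq> 0" for h
    by (rule taylor_form_nonzeroI[OF polyfun2_poly2 _ vertical that])
      (rule taylor_form_denominator_nonzero[OF cont pq(1,2) A(1,2) N])
  then have "poly2 q \<in> definite_order_at a N" by (rule definite_order_atI[OF polyfun2_poly2 N(1)])
  then show ?thesis by (rule definite_atI)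
qed

lemma Rk1_imp_definite_fraction:
  assumes "\<phi> \<in> Rk1 k"
  obtains P Q where "polyfun2 P" "definite_poly Q" "\<And>z. \<phi> z * Q z = P z"
proof -
  obtain A where A: "finite A" "regular_after_blowup A \<phi>" and Rk: "\<phi> \<in> Rk k"
    using assms unfolding Rk1_def by blast
  have cont: "continuous_on UNIV \<phi>" using Rk Ck_imp_continuous_on unfolding Rk_def by blast
  obtain p q where pq: "q \<noteq> 0" "coprime p q" "\<And>z. \<phi> z * poly2 q z = poly2 p z"
    by (rule Rk_imp_coprime_fraction[OF Rk]) (rule that)
  have "definite_at a (poly2 q)" for a
  proof (cases "a \<in> A")
    case True
    with A show ?thesis unfolding regular_after_blowup_iff
      by (intro definite_at_coprime_denominator[OF cont pq(2,3,1)]) blast+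
  next
    case False
    have "regular_on (- A) \<phi>" using A(2) by (simp add: regular_after_blowup_def)
    then obtain r s where s: "poly2 s a \<noteq> 0" "\<And>z. \<phi> z * poly2 s z = poly2 r z"
      by (rule regular_on_imp_global_fraction[OF cont]) (use A(1) False in \<open>auto intro: that\<close>)
    have "q dvd s" by (rule coprime_denominator_dvd[OF pq(2,3) s(2)])
    then have "poly2 q a \<noteq> 0" using s(1) by (elim dvdE) simp
    then show ?thesis by (intro definite_at_nonzero isCont_polyfun2 polyfun2_poly2)
  qed
  then have "definite_poly (poly2 q)" by (simp add: definite_poly_def polyfun2_poly2)
  then show ?thesis using that polyfun2_poly2 pq(3) by blast
qed

theorem Rk1_iff_definite_fraction:
  "\<phi> \<in> Rk1 k \<longleftrightarrow> Ck k \<phi> \<and> (\<exists>P Q. polyfun2 P \<and> definite_poly Q \<and> (\<forall>z. \<phi> z * Q z = P z))"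
proof
  assume "\<phi> \<in> Rk1 k"
  moreover from this have "Ck k \<phi>" by (simp add: Rk1_def Rk_def)
  ultimately show "Ck k \<phi> \<and> (\<exists>P Q. polyfun2 P \<and> definite_poly Q \<and> (\<forall>z. \<phi> z * Q z = P z))"
    using Rk1_imp_definite_fraction by metis
qed (use Rk1I in blast)

section \<open>Radicals of ideals\<close>

lemma polyfun2_in_Rk1: "polyfun2 p \<Longrightarrow> p \<in> Rk1 k"
  using CkOn_polyfun2[of p k UNIV] by (intro Rk1I[OF _ _ definite_poly_1]) (simp_all add: CkOn_UNIV)

lemma Rk1_imp_Ck: "g \<in> Rk1 k \<Longrightarrow> Ck k g"
  by (simp add: Rk1_iff_definite_fraction)

lemma Ck_imp_isCont: "Ck k g \<Longrightarrow> isCont g z"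
  using Ck_imp_continuous_on continuous_on_eq_continuous_at by blast

lemma is_ideal_inD:
  assumes "is_ideal_in R I"
  shows "(\<lambda>_. 0) \<in> I" "a \<in> I \<Longrightarrow> a \<in> R" "a \<in> I \<Longrightarrow> b \<in> I \<Longrightarrow> (\<lambda>z. a z + b z) \<in> I"
    "r \<in> R \<Longrightarrow> a \<in> I \<Longrightarrow> (\<lambda>z. r z * a z) \<in> I"
  using assms unfolding is_ideal_in_def by auto

lemma is_ideal_in_power:
  assumes "is_ideal_in R I" "a \<in> I" shows "(\<lambda>z. a z ^ Suc n) \<in> I"
proof (induction n)
  case (Suc n)
  show ?case using is_ideal_inD(4)[OF assms(1) is_ideal_inD(2)[OF assms] Suc.IH] by simp
qed (use assms in simp)

lemma radical_in_eq_principal: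
  assumes I: "is_ideal_in R I" and f: "f \<in> I"
    and pow: "\<And>g. g \<in> I \<Longrightarrow> \<exists>(N::nat) h. h \<in> R \<and> (\<lambda>z. g z ^ N) = (\<lambda>z. f z * h z)"
  shows "radical_in R I = radical_in R (principal_ideal R f)"
proof (intro set_eqI iffI)
  fix g assume "g \<in> radical_in R I"
  then obtain M where g: "g \<in> R" "(\<lambda>z. g z ^ M) \<in> I" unfolding radical_in_def by blast
  obtain N h where "h \<in> R" "(\<lambda>z. (g z ^ M) ^ N) = (\<lambda>z. f z * h z)" using pow[OF g(2)] by blast
  then have "(\<lambda>z. g z ^ (M * N)) \<in> principal_ideal R f" unfolding principal_ideal_def
    by (auto simp: power_mult)
  then show "g \<in> radical_in R (principal_ideal R f)" using g(1) unfolding radical_in_def by blast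
next
  fix g assume "g \<in> radical_in R (principal_ideal R f)"
  then obtain N h where g: "g \<in> R" "h \<in> R" "(\<lambda>z. g z ^ N) = (\<lambda>z. f z * h z)"
    unfolding radical_in_def principal_ideal_def by blast
  have "(\<lambda>z. h z * f z) \<in> I" by (rule is_ideal_inD(4)[OF I g(2) f])
  then have "(\<lambda>z. g z ^ N) \<in> I" by (simp add: g(3) mult.commute)
  then show "g \<in> radical_in R I" using g(1) unfolding radical_in_def by blast
qed

lemma ideal_positive_on_finite:
  assumes I: "is_ideal_in R I" and "finite B" "\<And>b. b \<in> B \<Longrightarrow> \<exists>g\<in>I. g b \<noteq> 0"
  shows "\<exists>G\<in>I. (\<forall>z. G z \<ge> 0) \<and> (\<forall>b\<in>B. G b > 0)"
  using assms(2,3)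
proof (induction B)
  case empty
  show ?case using is_ideal_inD(1)[OF I] by (intro bexI[of _ "\<lambda>_. 0"]) auto
next
  case (insert b B)
  then obtain G where G: "G \<in> I" "\<And>z. G z \<ge> 0" "\<And>b. b \<in> B \<Longrightarrow> G b > 0" by blast
  obtain g where g: "g \<in> I" "g b \<noteq> 0" using insert.prems by blast
  have mem: "(\<lambda>z. G z + g z ^ 2) \<in> I"
    using is_ideal_inD(3)[OF I G(1) is_ideal_in_power[OF I g(1), of 1]]
    by (simp add: power2_eq_square)
  show ?case
  proof (intro bexI[OF _ mem] conjI allI ballI)
    show "G z + g z ^ 2 \<ge> 0" for z using G(2) by simp
    show "G c + g c ^ 2 > 0" if "c \<in> insert b B" for c
    proof (cases "c = b")
      case True
      then show ?thesis using g(2) G(2) by (simp add: add_nonneg_pos)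
    next
      case False
      then show ?thesis using that G(3) by (simp add: add_pos_nonneg)
    qed
  qed
qed

definition zero_locus :: "(pt \<Rightarrow> real) set \<Rightarrow> pt set" where
  "zero_locus I = {z. \<forall>g\<in>I. g z = 0}"

definition ideal_gcd :: "(pt \<Rightarrow> real) set \<Rightarrow> pt \<Rightarrow> real" where
  "ideal_gcd I = poly2 (Gcd {p. poly2 p \<in> I})"

lemma polyfun2_ideal_gcd: "polyfun2 (ideal_gcd I)"
  unfolding ideal_gcd_def by (rule polyfun2_poly2)

lemma ideal_element_fraction:
  assumes I: "is_ideal_in (Rk1 k) I" and g: "g \<in> I"
  obtains P Q where "polyfun2 P" "definite_poly Q" "\<And>z. g z * Q z = ideal_gcd I z * P z"
proof -
  obtain p Q where pQ: "polyfun2 p" "definite_poly Q" "\<And>z. g z * Q z = p z"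
    by (rule Rk1_imp_definite_fraction[OF is_ideal_inD(2)[OF I g]]) (rule that)
  obtain p' where p': "p = poly2 p'" using pQ(1) by (rule polyfun2E)
  have "(\<lambda>z. Q z * g z) \<in> I"
    by (rule is_ideal_inD(4)[OF I polyfun2_in_Rk1[OF definite_polyD(1)[OF pQ(2)]] g])
  then have "poly2 p' \<in> I" using pQ(3) by (simp add: mult.commute flip: p')
  then have "Gcd {p. poly2 p \<in> I} dvd p'" by (intro Gcd_dvd) simp
  then obtain P where "p' = Gcd {p. poly2 p \<in> I} * P" by (elim dvdE)
  then have "g z * Q z = ideal_gcd I z * poly2 P z" for z using pQ(3)
    by (simp add: p' ideal_gcd_def)
  then show ?thesis using that polyfun2_poly2 pQ(2) by blast
qed

lemma ideal_definite_mult_gcd: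
  assumes I: "is_ideal_in (Rk1 k) I"
  obtains D where "definite_poly D" "(\<lambda>z. ideal_gcd I z * D z) \<in> I"
proof -
  have "ring_ideal {p. poly2 p \<in> I}"
    using is_ideal_inD[OF I] polyfun2_in_Rk1[OF polyfun2_poly2]
    by (intro ring_idealI) (simp_all add: poly2_simps(1,3,5)[abs_def])
  then obtain D where "definite_poly (poly2 D)" "D * Gcd {p. poly2 p \<in> I} \<in> {p. poly2 p \<in> I}"
    by (rule ideal_definite_mult_Gcd)
  then show ?thesis
    by (intro that) (simp_all add: ideal_gcd_def poly2_simps(5)[abs_def] mult.commute)
qed

lemma definite_at_of_nonzero_fraction:
  assumes "isCont f z" "f z \<noteq> 0" "definite_at z V" and poly: "polyfun2 d" "polyfun2 P"
    and eq: "\<And>w. f w * V w = d w * P w"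
  shows "definite_at z d" "definite_at z P"
proof -
  have "definite_at z (\<lambda>w. f w * V w)" by (intro definite_at_mult definite_at_nonzero assms(1-3))
  then have dP: "definite_at z (\<lambda>w. d w * P w)" by (simp only: eq)
  then show "definite_at z d" by (rule definite_at_factor[OF poly])
  have "definite_at z (\<lambda>w. P w * d w)" using dP by (simp only: mult.commute)
  then show "definite_at z P" by (rule definite_at_factor[OF poly(2,1)])
qed

lemma numerator_vanishing_at_Suc:
  assumes "isCont g z" "g z = 0" "V \<in> vanishing_at z m" and "polyfun2 p" "\<And>w. g w * V w = p w"
  shows "p \<in> vanishing_at z (Suc m)"
proof -
  have "g \<in> o[at z](\<lambda>_. 1)" using assms(1,2) by (intro smalloI_tendsto) (simp_all add: isCont_def)
  then have "(\<lambda>w. g w * V w) \<in> o[at z](\<lambda>w. 1 * dist w z ^ m)" using assms(3)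
    by (rule landau_o.small_big_mult)
  then show ?thesis using assms(5) by (intro vanishing_at_Suc_of_smallo[OF assms(4)]) simp
qed

lemma numerator_power_mult_vanishing_at:
  assumes "isCont g z" "g z = 0" "V \<in> vanishing_at z l" "polyfun2 p" "\<And>w. g w * V w = p w"
    and "polyfun2 r" "m \<le> Suc l * n"
  shows "(\<lambda>w. p w ^ n * r w) \<in> vanishing_at z m"
proof -
  have "p \<in> vanishing_at z (Suc l)" by (rule numerator_vanishing_at_Suc[OF assms(1-5)])
  then have "(\<lambda>w. p w ^ n) \<in> vanishing_at z (Suc l * n)" unfolding power_mult
    by (rule landau_o.big_power)
  then have "(\<lambda>w. p w ^ n * r w) \<in> O[at z](\<lambda>w. dist w z ^ (Suc l * n) * 1)"
    by (intro landau_o.big.mult isCont_bigo_1 isCont_polyfun2 assms(6))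
  then have "(\<lambda>w. p w ^ n * r w) \<in> vanishing_at z (Suc l * n)" by simp
  then show ?thesis by (rule landau_o.big_trans) (rule vanishing_at_dist_power[OF assms(7)])
qed

lemma definite_at_sum_squares:
  assumes f: "f \<in> definite_order_at z m" and g: "g \<in> vanishing_at z (Suc m)"
  shows "definite_at z (\<lambda>w. f w ^ 2 + g w ^ 2)"
proof -
  have f2: "(\<lambda>w. f w ^ 2) \<in> \<Theta>[at z](\<lambda>w. (dist w z ^ m) ^ 2)" by (rule bigtheta_power[OF f])
  have "(\<lambda>w. dist w z ^ Suc m) \<in> o[at z](\<lambda>w. dist w z ^ m)" by (rule dist_power_smallo) simp
  with g have "g \<in> o[at z](\<lambda>w. dist w z ^ m)" by (rule landau_o.big_small_trans)
  then have "(\<lambda>w. g w ^ 2) \<in> o[at z](\<lambda>w. (dist w z ^ m) ^ 2)" by (rule landau_o.small_power) simp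
  also have "(\<lambda>w. (dist w z ^ m) ^ 2) \<in> \<Theta>[at z](\<lambda>w. f w ^ 2)" using f2 by (simp add: bigtheta_sym)
  finally have "(\<lambda>w. f w ^ 2 + g w ^ 2) \<in> \<Theta>[at z](\<lambda>w. (dist w z ^ m) ^ 2) \<longleftrightarrow>
      (\<lambda>w. f w ^ 2) \<in> \<Theta>[at z](\<lambda>w. (dist w z ^ m) ^ 2)"
    by (subst (1 2) bigtheta_sym) (simp only: landau_theta.plus_absorb2)
  with f2 show ?thesis unfolding power_mult[symmetric] by (intro definite_atI) blast
qed

lemma finite_gcd_zeros_off_locus:
  assumes I: "is_ideal_in (Rk1 k) I" shows "finite ({z. ideal_gcd I z = 0} - zero_locus I)"
proof -
  have "definite_at z (ideal_gcd I)" if "z \<notin> zero_locus I" for z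
  proof -
    obtain g where g: "g \<in> I" "g z \<noteq> 0" using \<open>z \<notin> zero_locus I\<close> by (auto simp: zero_locus_def)
    obtain P Q where PQ: "polyfun2 P" "definite_poly Q" "\<And>z. g z * Q z = ideal_gcd I z * P z"
      by (rule ideal_element_fraction[OF I g(1)]) (rule that)
    have "isCont g z" by (rule Ck_imp_isCont[OF Rk1_imp_Ck[OF is_ideal_inD(2)[OF I g(1)]]])
    then show ?thesis
      by (rule definite_at_of_nonzero_fraction(1)[OF _ g(2) definite_polyD(2)[OF PQ(2)]
          polyfun2_ideal_gcd PQ(1,3)])
  qed
  then have "{z. ideal_gcd I z = 0} - zero_locus I \<subseteq>
      {z. ideal_gcd I z = 0 \<and> definite_at z (ideal_gcd I)}" by blast
  then show ?thesis by (rule finite_subset) (rule finite_definite_zeros[OF polyfun2_ideal_gcd])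
qed

lemma CkOn_fraction_near:
  assumes PQ: "polyfun2 P" "polyfun2 Q" and Q: "Q \<in> definite_order_at z m"
    and P: "P \<in> vanishing_at z (m + Suc k)"
    and "h z = 0" and eq: "\<forall>\<^sub>F w in at z. h w * Q w = P w"
  shows "\<exists>U. open U \<and> z \<in> U \<and> CkOn k U h"
proof -
  have "\<forall>\<^sub>F w in at z. Q w \<noteq> 0" by (intro definite_at_eventually_nonzero definite_atI[OF Q])
  with eq have "\<forall>\<^sub>F w in at z. Q w \<noteq> 0 \<and> h w * Q w = P w" by eventually_elim simp
  then obtain U where U: "open U" "z \<in> U" "\<And>w. w \<in> U \<Longrightarrow> w \<noteq> z \<Longrightarrow> Q w \<noteq> 0 \<and> h w * Q w = P w"
    unfolding eventually_at_topological by blast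
  have "P z = 0" using vanishing_at_imp_eq_0[OF PQ(1)] P by simp
  have "CkOn k U (\<lambda>w. P w / Q w)" by (rule CkOn_quotient[OF PQ _ Q P]) (use U(3) in blast)
  moreover have "P w / Q w = h w" if "w \<in> U" for w
    using U(3)[OF that] \<open>h z = 0\<close> \<open>P z = 0\<close> by (cases "w = z") (auto simp: field_simps)
  ultimately have "CkOn k U h" by (rule CkOn_cong[OF _ U(1)])
  then show ?thesis using U(1,2) by blast
qed

lemma power_quotient_identity:
  fixes g Q d P f V W :: real
  assumes "g * Q = d * P" "f * V ^ 2 = d ^ 2 * W" "V \<noteq> 0" "n > 0"
    and "f = 0 \<Longrightarrow> g = 0"
  shows "g ^ (n + 2) / f * (Q ^ (n + 2) * W) = (d * P) ^ n * (P * V) ^ 2"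
proof (cases "d = 0")
  case True
  then show ?thesis using assms(2-4) by simp
next
  case False
  have "d ^ 2 * (g ^ (n + 2) / f * (Q ^ (n + 2) * W)) = g ^ (n + 2) / f * Q ^ (n + 2) * (d ^ 2 * W)"
    by (simp only: mult_ac)
  also have "\<dots> = g ^ (n + 2) / f * f * Q ^ (n + 2) * V ^ 2"
    unfolding assms(2)[symmetric] by (simp only: mult_ac)
  also have "g ^ (n + 2) / f * f = g ^ (n + 2)" using assms(5) by (cases "f = 0") simp_all
  also have "g ^ (n + 2) * Q ^ (n + 2) * V ^ 2 = (g * Q) ^ (n + 2) * V ^ 2"
    by (simp only: power_mult_distrib)
  also have "\<dots> = d ^ 2 * ((d * P) ^ n * (P * V) ^ 2)"
    unfolding assms(1) by (simp only: power_add power_mult_distrib mult_ac)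
  finally show ?thesis by (rule mult_left_cancel[THEN iffD1, rotated]) (use False in simp)
qed

lemma Ck_quotient:
  assumes f: "Ck k f" and g: "Ck k g"
    and zeros: "\<And>z. f z = 0 \<Longrightarrow> \<exists>U. open U \<and> z \<in> U \<and> CkOn k U (\<lambda>w. g w / f w)"
  shows "Ck k (\<lambda>z. g z / f z)"
proof (rule Ck_local)
  fix z
  show "\<exists>U. open U \<and> z \<in> U \<and> CkOn k U (\<lambda>w. g w / f w)"
  proof (cases "f z = 0")
    case False
    let ?U = "{w. f w \<noteq> 0}"
    have "CkOn k ?U (\<lambda>w. g w * (1 / f w))"
      using f g
      by (intro CkOn_mult CkOn_inverse CkOn_subset[of k UNIV _ ?U]) (simp_all add: CkOn_UNIV)
    moreover have "open ?U"
      by (intro open_Collect_neq Ck_imp_continuous_on[OF f] continuous_on_const)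
    ultimately show ?thesis using False by (intro exI[of _ ?U]) simp
  qed (rule zeros)
qed

lemma Ck_power_quotient:
  assumes f: "Ck k f" and g: "Ck k g" and d: "polyfun2 d" and P: "polyfun2 P"
    and Q: "definite_poly Q" and V: "definite_poly V" and W: "definite_poly W"
    and gQ: "\<And>z. g z * Q z = d z * P z" and fV: "\<And>z. f z * V z ^ 2 = d z ^ 2 * W z"
    and zero: "\<And>z. f z = 0 \<Longrightarrow> g z = 0"
  obtains n where "n > 0" "Ck k (\<lambda>z. g z ^ (n + 2) / f z)"
proof -
  note poly = d P definite_polyD(1)[OF Q] definite_polyD(1)[OF V] definite_polyD(1)[OF W]
  obtain b where b: "\<And>z m. Q \<in> definite_order_at z m \<Longrightarrow> m \<le> b"
    by (rule bounded_definite_order_at[OF poly(3)]) (rule that)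
  obtain c where c: "\<And>z m. W \<in> definite_order_at z m \<Longrightarrow> m \<le> c"
    by (rule bounded_definite_order_at[OF poly(5)]) (rule that)
  define n where "n = 2 * b + c + Suc k"
  let ?num = "\<lambda>z. (d z * P z) ^ n * (P z * V z) ^ 2" and ?den = "\<lambda>z. Q z ^ (n + 2) * W z"
  have "Ck k (\<lambda>z. g z ^ (n + 2) / f z)"
  proof (rule Ck_quotient[OF f])
    show "Ck k (\<lambda>z. g z ^ (n + 2))" using CkOn_power[of k UNIV g "n + 2"] g
      by (simp only: CkOn_UNIV)
    fix z assume "f z = 0"
    obtain q where q: "Q \<in> definite_order_at z q" by (rule definite_atE[OF definite_polyD(2)[OF Q]])
    obtain r where r: "W \<in> definite_order_at z r" by (rule definite_atE[OF definite_polyD(2)[OF W]])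
    show "\<exists>U. open U \<and> z \<in> U \<and> CkOn k U (\<lambda>w. g w ^ (n + 2) / f w)"
    proof (rule CkOn_fraction_near)
      show "polyfun2 ?num" "polyfun2 ?den" by (intro polyfun2_intros poly)+
      show "?den \<in> definite_order_at z (q * (n + 2) + r)"
        unfolding power_add[of _ "q * (n + 2)"] power_mult
        by (intro landau_theta.mult bigtheta_power q r)
      show "?num \<in> vanishing_at z (q * (n + 2) + r + Suc k)"
      proof (rule numerator_power_mult_vanishing_at[OF Ck_imp_isCont[OF g] zero[OF \<open>f z = 0\<close>]
          bigthetaD1[OF q] polyfun2_mult[OF d P] gQ])
        show "polyfun2 (\<lambda>z. (P z * V z) ^ 2)" by (intro polyfun2_intros poly)
        show "q * (n + 2) + r + Suc k \<le> Suc q * n" using b[OF q] c[OF r] by (simp add: n_def)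
      qed
      have "n > 0" by (simp add: n_def)
      show "\<forall>\<^sub>F w in at z. g w ^ (n + 2) / f w * ?den w = ?num w"
        using definite_at_eventually_nonzero[OF definite_polyD(2)[OF V]]
        by eventually_elim (rule power_quotient_identity[OF gQ fV _ \<open>n > 0\<close> zero])
    qed (simp add: \<open>f z = 0\<close>)
  qed
  then show ?thesis by (rule that[rotated]) (simp add: n_def)
qed

text \<open>The witness is \<open>g\<^sup>N / f\<close>, which is 0 on the zero set of \<open>f\<close> by the convention \<open>x / 0 = 0\<close>.\<close>
lemma power_dvd_in_Rk1:
  assumes f: "Ck k f" and g: "Ck k g" and d: "polyfun2 d" and P: "polyfun2 P"
    and Q: "definite_poly Q" and V: "definite_poly V" and W: "definite_poly W"
    and gQ: "\<And>z. g z * Q z = d z * P z" and fV: "\<And>z. f z * V z ^ 2 = d z ^ 2 * W z"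
    and zero: "\<And>z. f z = 0 \<Longrightarrow> g z = 0"
  shows "\<exists>(N::nat) h. h \<in> Rk1 k \<and> (\<lambda>z. g z ^ N) = (\<lambda>z. f z * h z)"
proof -
  obtain n where n: "n > 0" and Ck: "Ck k (\<lambda>z. g z ^ (n + 2) / f z)" (is "Ck k ?h")
    by (rule Ck_power_quotient[OF f g d P Q V W gQ fV]) (erule zero, rule that)
  let ?num = "\<lambda>z. (d z * P z) ^ n * (P z * V z) ^ 2" and ?den = "\<lambda>z. Q z ^ (n + 2) * W z"
  have V_poly: "polyfun2 V" by (rule definite_polyD(1)[OF V])
  have num: "polyfun2 ?num" by (intro polyfun2_intros d P V_poly)
  have den: "definite_poly ?den" by (intro definite_poly_mult definite_poly_power Q W)
  have "?h z * ?den z = ?num z" for z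
  proof (rule continuous_eq_off_zeros[OF V_poly definite_poly_neq_0[OF V] finite.emptyI])
    show "continuous_on UNIV (\<lambda>z. ?h z * ?den z)"
      by (intro continuous_on_mult[OF Ck_imp_continuous_on[OF Ck]] continuous_on_polyfun2
          definite_polyD(1)[OF den])
    show "continuous_on UNIV ?num" by (rule continuous_on_polyfun2[OF num])
    show "?h z * ?den z = ?num z" if "V z \<noteq> 0" for z
      by (rule power_quotient_identity[OF gQ fV that n zero])
  qed
  then have "?h \<in> Rk1 k" by (rule Rk1I[OF Ck num den])
  moreover have "g z ^ (n + 2) = f z * ?h z" for z using zero[of z] by (cases "f z = 0") simp_all
  ultimately show ?thesis by blast
qed

text \<open>
  At a zero of \<open>G\<close> the product \<open>d P\<close> vanishes to a higher order than \<open>V\<close>, so for large \<open>n\<close> the first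
  square dominates.
\<close>
lemma definite_at_sum_squares_numerator:
  assumes D: "D \<in> definite_order_at z m" and V: "V \<in> definite_order_at z l"
    and poly: "polyfun2 d" "polyfun2 P" and G: "isCont G z" "G z = 0" "\<And>w. G w * V w = d w * P w"
    and "m + l < n"
  shows "definite_at z (\<lambda>w. (D w * V w ^ Suc n) ^ 2 + (d w ^ n * P w ^ Suc n) ^ 2)"
proof (rule definite_at_sum_squares)
  show "(\<lambda>w. D w * V w ^ Suc n) \<in> definite_order_at z (m + l * Suc n)"
    unfolding power_add power_mult by (intro landau_theta.mult D bigtheta_power V)
  have "(\<lambda>w. (d w * P w) ^ n * P w) \<in> vanishing_at z (Suc (m + l * Suc n))"
  proof (rule numerator_power_mult_vanishing_at[OF G(1,2) _ polyfun2_mult[OF poly] G(3) poly(2)])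
    show "V \<in> vanishing_at z l" using V by blast
    show "Suc (m + l * Suc n) \<le> Suc l * n" using \<open>m + l < n\<close> by simp
  qed
  then show "(\<lambda>w. d w ^ n * P w ^ Suc n) \<in> vanishing_at z (Suc (m + l * Suc n))"
    by (simp add: power_mult_distrib mult_ac)
qed

lemma sum_squares_numerator_identity:
  fixes G V d P D :: "'a::comm_ring_1"
  assumes "G * V = d * P"
  shows "((d * D) ^ 2 + (G ^ Suc n) ^ 2) * (V ^ Suc n) ^ 2 =
      d ^ 2 * ((D * V ^ Suc n) ^ 2 + (d ^ n * P ^ Suc n) ^ 2)"
proof -
  have "((d * D) ^ 2 + (G ^ Suc n) ^ 2) * (V ^ Suc n) ^ 2 =
      (d * D * V ^ Suc n) ^ 2 + ((G * V) ^ Suc n) ^ 2"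
    by (simp only: distrib_right power_mult_distrib)
  also have "\<dots> = d ^ 2 * ((D * V ^ Suc n) ^ 2 + (d ^ n * P ^ Suc n) ^ 2)"
    unfolding assms by (simp add: power_mult_distrib distrib_left mult_ac)
  finally show ?thesis .
qed

lemma definite_poly_sum_squares_numerator:
  assumes D: "definite_poly D" and V: "definite_poly V" and poly: "polyfun2 d" "polyfun2 P"
    and G: "\<And>z. isCont G z" "\<And>z. G z * V z = d z * P z"
  obtains n where "definite_poly (\<lambda>w. (D w * V w ^ Suc n) ^ 2 + (d w ^ n * P w ^ Suc n) ^ 2)"
proof -
  note polys = poly definite_polyD(1)[OF D] definite_polyD(1)[OF V]
  obtain m where m: "\<And>z i. D \<in> definite_order_at z i \<Longrightarrow> i \<le> m"
    by (rule bounded_definite_order_at[OF polys(3)]) (rule that)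
  obtain l where l: "\<And>z i. V \<in> definite_order_at z i \<Longrightarrow> i \<le> l"
    by (rule bounded_definite_order_at[OF polys(4)]) (rule that)
  define n where "n = Suc (m + l)"
  define W where "W = (\<lambda>z. (D z * V z ^ Suc n) ^ 2 + (d z ^ n * P z ^ Suc n) ^ 2)"
  have W: "polyfun2 W" unfolding W_def by (intro polyfun2_intros polys)
  have "definite_at z W" for z
  proof (cases "G z = 0")
    case True
    obtain i where i: "D \<in> definite_order_at z i" by (rule definite_atE[OF definite_polyD(2)[OF D]])
    obtain j where j: "V \<in> definite_order_at z j" by (rule definite_atE[OF definite_polyD(2)[OF V]])
    have "i + j < n" using m[OF i] l[OF j] by (simp add: n_def)
    then show ?thesis unfolding W_def
      by (rule definite_at_sum_squares_numerator[OF i j poly G(1) True G(2)])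
  next
    case False
    let ?f = "\<lambda>z. (d z * D z) ^ 2 + (G z ^ Suc n) ^ 2"
    have fW: "?f w * (V w ^ Suc n) ^ 2 = d w ^ 2 * W w" for w
      unfolding W_def by (rule sum_squares_numerator_identity[OF G(2)])
    show ?thesis
    proof (rule definite_at_of_nonzero_fraction(2)[OF _ _ _ _ W fW])
      show "isCont ?f z" by (intro continuous_intros isCont_polyfun2 polys G(1))
      show "?f z \<noteq> 0" using False by (simp add: sum_power2_eq_zero_iff)
      show "definite_at z (\<lambda>w. (V w ^ Suc n) ^ 2)"
        by (intro definite_polyD(2) definite_poly_power V)
      show "polyfun2 (\<lambda>z. d z ^ 2)" by (rule polyfun2_power[OF poly(1)])
    qed
  qed
  then have "definite_poly W" using W by (simp add: definite_poly_def)
  then show ?thesis unfolding W_def by (rule that)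
qed

lemma exists_nonzero_off_locus:
  assumes I: "is_ideal_in (Rk1 k) I" and D: "definite_poly D"
  obtains G where "G \<in> I" "\<And>z. z \<notin> zero_locus I \<Longrightarrow> ideal_gcd I z * D z = 0 \<Longrightarrow> G z \<noteq> 0"
proof -
  let ?B = "({z. ideal_gcd I z = 0} \<union> {z. D z = 0}) - zero_locus I"
  have "finite ?B"
    using finite_gcd_zeros_off_locus[OF I] finite_zeros_definite_poly[OF D] by (simp add: Un_Diff)
  moreover have "\<exists>g\<in>I. g b \<noteq> 0" if "b \<in> ?B" for b using that by (auto simp: zero_locus_def)
  ultimately have "\<exists>G\<in>I. (\<forall>z. G z \<ge> 0) \<and> (\<forall>b\<in>?B. G b > 0)" by (rule ideal_positive_on_finite[OF I])
  then obtain G where G: "G \<in> I" "\<forall>b\<in>?B. G b > 0" by blast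
  have "G z \<noteq> 0" if "z \<notin> zero_locus I" "ideal_gcd I z * D z = 0" for z
    using bspec[OF G(2), of z] that by auto
  with G(1) show ?thesis by (rule that)
qed

lemma exists_definite_multiple_of_gcd_square:
  assumes I: "is_ideal_in (Rk1 k) I"
  obtains f V W where "f \<in> I" "\<And>z. f z = 0 \<Longrightarrow> z \<in> zero_locus I" "definite_poly V" "definite_poly W"
    "\<And>z. f z * V z ^ 2 = ideal_gcd I z ^ 2 * W z"
proof -
  let ?d = "ideal_gcd I"
  obtain D where D: "definite_poly D" "(\<lambda>z. ?d z * D z) \<in> I" by (rule ideal_definite_mult_gcd[OF I])
  obtain G where G: "G \<in> I" "\<And>z. z \<notin> zero_locus I \<Longrightarrow> ?d z * D z = 0 \<Longrightarrow> G z \<noteq> 0"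
    by (rule exists_nonzero_off_locus[OF I D(1)]) (rule that)
  obtain P V where V: "polyfun2 P" "definite_poly V" "\<And>z. G z * V z = ?d z * P z"
    by (rule ideal_element_fraction[OF I G(1)]) (rule that)
  have "isCont G z" for z by (rule Ck_imp_isCont[OF Rk1_imp_Ck[OF is_ideal_inD(2)[OF I G(1)]]])
  then obtain n
    where W: "definite_poly (\<lambda>w. (D w * V w ^ Suc n) ^ 2 + (?d w ^ n * P w ^ Suc n) ^ 2)"
    by (rule definite_poly_sum_squares_numerator[OF D(1) V(2) polyfun2_ideal_gcd V(1) _ V(3)])
  let ?f = "\<lambda>z. (?d z * D z) ^ 2 + (G z ^ Suc n) ^ 2"
  show ?thesis
  proof (rule that)
    show "?f \<in> I" unfolding numeral_2_eq_2
      by (intro is_ideal_inD(3)[OF I] is_ideal_in_power[OF I] D(2) G(1))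
    show "z \<in> zero_locus I" if "?f z = 0" for z
      using G(2)[of z] that by (auto simp: sum_power2_eq_zero_iff)
    show "definite_poly (\<lambda>z. V z ^ Suc n)" by (rule definite_poly_power[OF V(2)])
    show "?f z * (V z ^ Suc n) ^ 2 =
        ?d z ^ 2 * ((D z * V z ^ Suc n) ^ 2 + (?d z ^ n * P z ^ Suc n) ^ 2)" for z
      by (rule sum_squares_numerator_identity[OF V(3)])
  qed (rule W)
qed

theorem theorem5p16:
  fixes k :: nat and I :: "(pt \<Rightarrow> real) set"
  assumes "is_ideal_in (Rk1 k) I"
  shows "\<exists>f\<in>I. (\<forall>g\<in>I. \<exists>(N::nat) h. h \<in> Rk1 k \<and> (\<lambda>z. g z ^ N) = (\<lambda>z. f z * h z))
              \<and> radical_in (Rk1 k) I = radical_in (Rk1 k) (principal_ideal (Rk1 k) f)"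
proof -
  obtain f V W where f: "f \<in> I" "\<And>z. f z = 0 \<Longrightarrow> z \<in> zero_locus I"
    and VW: "definite_poly V" "definite_poly W"
    and fW: "\<And>z. f z * V z ^ 2 = ideal_gcd I z ^ 2 * W z"
    by (rule exists_definite_multiple_of_gcd_square[OF assms]) (rule that)
  have Ck: "Ck k g" if "g \<in> I" for g using Rk1_imp_Ck is_ideal_inD(2)[OF assms that] .
  have pow: "\<exists>(N::nat) h. h \<in> Rk1 k \<and> (\<lambda>z. g z ^ N) = (\<lambda>z. f z * h z)" if g: "g \<in> I" for g
  proof -
    obtain P Q where PQ: "polyfun2 P" "definite_poly Q" "\<And>z. g z * Q z = ideal_gcd I z * P z"
      by (rule ideal_element_fraction[OF assms g]) (rule that)
    have "g z = 0" if "f z = 0" for z using f(2)[OF that] g by (simp add: zero_locus_def)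
    then show ?thesis
      by (rule power_dvd_in_Rk1[OF Ck[OF f(1)] Ck[OF g] polyfun2_ideal_gcd PQ(1,2) VW PQ(3) fW])
  qed
  from radical_in_eq_principal[OF assms f(1) pow] pow f(1) show ?thesis by blast
qed

end
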